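(* Let $G$ be a finite group of $F$-class at least $1$ with covering group $G^*$ and multiplicator $M = M(G)$ (with respect to a generating tuple $g_1,\dots,g_n$). Then: (a) $\eta_G$ is surjective, so $\mathrm{Aut}_M(G^* )/W \cong \mathrm{Aut}(G)$; (b) $W/V \cong \eta_M(W) = \mathrm{Stab}_C([\epsilon])$; (c) $V \cong Z^1(G,M)$.
   Context: For a finite group $G$, $F(G)$ denotes its Fitting subgroup; the $F$-central series $\nu_0(G)=F(G)\ge\nu_1(G)\ge\cdots$ is defined by letting $\nu_{i+1}(G)$ be the smallest normal subgroup $N$ of $F(G)$ with $N\le\nu_i(G)$ such that $\nu_i(G)/N$ is centralized by $F(G)$ and is a direct product of elementary abelian groups; the $F$-rank (for $F$-class $\ge1$) is $\ell=|\nu_0(G)/\nu_1(G)|$ and $k$ is the product of the distinct primes dividing $\ell$. Let $F$ be free on $f_1,\dots,f_n$, $\mu:F\to G$, $f_i\mapsto g_i$, $R=\ker\mu$, $L=\mu^{-1}(F(G))$, $K(G)=[R,L]R^k$, $G^*=F/K(G)$, $M=R/K(G)$; $M$ is abelian and normal in $G^*$, and $G^*/M$ is identified with $G$. $\mathrm{Aut}_M(G^* )$ is the group of automorphisms of $G^*$ leaving $M$ setwise invariant; $\eta_G:\mathrm{Aut}_M(G^* )\to\mathrm{Aut}(G)$ sends $\alpha$ to the automorphism $gM\mapsto\alpha(g)M$ of $G^*/M=G$, and $\eta_M:\mathrm{Aut}_M(G^* )\to\mathrm{Aut}(M)$ sends $\alpha$ to $\alpha|_M$. $W=\ker\eta_G$,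 $V=\ker\eta_G\cap\ker\eta_M$. Let $\gamma:G\to\mathrm{Aut}(M)$ be the action of $G$ on $M$ induced by conjugation in $G^*$, and $C$ the centralizer in $\mathrm{Aut}(M)$ of $\gamma(G)$. $Z^1(G,M)$, $Z^2(G,M)$, $B^2(G,M)$, $H^2(G,M)$ are taken with respect to $\gamma$; $C$ acts on $Z^2(G,M)$ by $(c(\delta))(g,h)=c(\delta(g,h))$, inducing an action on $H^2(G,M)$ by $c([\delta])=[c(\delta)]$. $\epsilon\in Z^2(G,M)$ is a cocycle defining $G^*$ as an extension of $M$ by $G$, and $[\epsilon]=\epsilon+B^2(G,M)$. *)

theory Defs
  imports "HOL-Algebra.Algebra" "HOL-Computational_Algebra.Squarefree"
begin

text \<open>A letter (True, i) stands for f_i, (False, i) for f_i^-1.\<close>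

definition letter_inv :: "bool \<times> nat \<Rightarrow> bool \<times> nat" where
  "letter_inv x = (\<not> fst x, snd x)"

fun reduced_word :: "(bool \<times> nat) list \<Rightarrow> bool" where
  "reduced_word [] = True"
| "reduced_word [x] = True"
| "reduced_word (x # y # ws) = (y \<noteq> letter_inv x \<and> reduced_word (y # ws))"

definition cons_red :: "bool \<times> nat \<Rightarrow> (bool \<times> nat) list \<Rightarrow> (bool \<times> nat) list" where
  "cons_red x w = (case w of [] \<Rightarrow> [x] | y # ws \<Rightarrow> (if y = letter_inv x then ws else x # w))"

definition free_group :: "nat \<Rightarrow> (bool \<times> nat) list monoid" where
  "free_group n = \<lparr>carrier = {w. reduced_word w \<and> (\<forall>x\<in>set w. snd x < n)},
                   monoid.mult = (\<lambda>v w. foldr cons_red v w),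
                   one = []\<rparr>"

definition free_lift :: "('a, 'b) monoid_scheme \<Rightarrow> 'a list \<Rightarrow> (bool \<times> nat) list \<Rightarrow> 'a" where
  "free_lift G gs w = foldr (\<lambda>x acc. (if fst x then gs ! snd x else inv\<^bsub>G\<^esub> (gs ! snd x)) \<otimes>\<^bsub>G\<^esub> acc) w \<one>\<^bsub>G\<^esub>"

definition comm_subgroup :: "('a, 'b) monoid_scheme \<Rightarrow> 'a set \<Rightarrow> 'a set \<Rightarrow> 'a set" where
  "comm_subgroup G A B = generate G {a \<otimes>\<^bsub>G\<^esub> b \<otimes>\<^bsub>G\<^esub> inv\<^bsub>G\<^esub> a \<otimes>\<^bsub>G\<^esub> inv\<^bsub>G\<^esub> b | a b. a \<in> A \<and> b \<in> B}"

fun lower_central :: "('a, 'b) monoid_scheme \<Rightarrow> 'a set \<Rightarrow> nat \<Rightarrow> 'a set" where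
  "lower_central G N 0 = N"
| "lower_central G N (Suc i) = comm_subgroup G (lower_central G N i) N"

definition nilpotent_subgroup :: "('a, 'b) monoid_scheme \<Rightarrow> 'a set \<Rightarrow> bool" where
  "nilpotent_subgroup G N \<longleftrightarrow> subgroup N G \<and> (\<exists>c. lower_central G N c = {\<one>\<^bsub>G\<^esub>})"

text \<open>Fitting subgroup: the subgroup generated by all nilpotent normal subgroups
  (for finite G this is the largest nilpotent normal subgroup).\<close>

definition fitting :: "('a, 'b) monoid_scheme \<Rightarrow> 'a set" where
  "fitting G = generate G (\<Union>{N. N \<lhd> G \<and> nilpotent_subgroup G N})"

text \<open>The F-central series. nu_{i+1} is the smallest normal subgroup N of F(G) with N \<le> nu_i,
  such that nu_i/N is centralized by F(G) (i.e. [nu_i, F(G)] \<le> N) and nu_i/N is a direct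
  product of elementary abelian groups (i.e. an abelian group of squarefree exponent).\<close>

fun F_central :: "('a, 'b) monoid_scheme \<Rightarrow> nat \<Rightarrow> 'a set" where
  "F_central G 0 = fitting G"
| "F_central G (Suc i) =
     \<Inter>{N. N \<lhd> (G\<lparr>carrier := fitting G\<rparr>) \<and> N \<subseteq> F_central G i
          \<and> comm_subgroup G (F_central G i) (fitting G) \<subseteq> N
          \<and> (\<exists>m::nat. m > 0 \<and> squarefree m \<and> (\<forall>x \<in> F_central G i. x [^]\<^bsub>G\<^esub> m \<in> N))}"

definition F_rank :: "('a, 'b) monoid_scheme \<Rightarrow> nat" where
  "F_rank G = card (F_central G 0) div card (F_central G 1)"

definition F_k :: "('a, 'b) monoid_scheme \<Rightarrow> nat" where
  "F_k G = \<Prod>(prime_factors (F_rank G))"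

abbreviation FreeG :: "'a list \<Rightarrow> (bool \<times> nat) list monoid" where
  "FreeG gs \<equiv> free_group (length gs)"

definition Rker :: "('a, 'b) monoid_scheme \<Rightarrow> 'a list \<Rightarrow> (bool \<times> nat) list set" where
  "Rker G gs = kernel (FreeG gs) G (free_lift G gs)"

definition Lpre :: "('a, 'b) monoid_scheme \<Rightarrow> 'a list \<Rightarrow> (bool \<times> nat) list set" where
  "Lpre G gs = {w \<in> carrier (FreeG gs). free_lift G gs w \<in> fitting G}"

definition Kgrp :: "('a, 'b) monoid_scheme \<Rightarrow> 'a list \<Rightarrow> (bool \<times> nat) list set" where
  "Kgrp G gs = generate (FreeG gs)
     ({r \<otimes>\<^bsub>FreeG gs\<^esub> l \<otimes>\<^bsub>FreeG gs\<^esub> inv\<^bsub>FreeG gs\<^esub> r \<otimes>\<^bsub>FreeG gs\<^esub> inv\<^bsub>FreeG gs\<^esub> l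
        | r l. r \<in> Rker G gs \<and> l \<in> Lpre G gs}
      \<union> {r [^]\<^bsub>FreeG gs\<^esub> F_k G | r. r \<in> Rker G gs})"

definition Gstar :: "('a, 'b) monoid_scheme \<Rightarrow> 'a list \<Rightarrow> (bool \<times> nat) list set monoid" where
  "Gstar G gs = FreeG gs Mod Kgrp G gs"

definition Mset :: "('a, 'b) monoid_scheme \<Rightarrow> 'a list \<Rightarrow> (bool \<times> nat) list set set" where
  "Mset G gs = {r_coset (FreeG gs) (Kgrp G gs) r | r. r \<in> Rker G gs}"

text \<open>The induced projection G* -> G, whose kernel is M (identifying G*/M with G).\<close>

definition proj :: "('a, 'b) monoid_scheme \<Rightarrow> 'a list \<Rightarrow> (bool \<times> nat) list set \<Rightarrow> 'a" where
  "proj G gs Y = free_lift G gs (SOME w. w \<in> Y)"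

definition lift_elt :: "('a, 'b) monoid_scheme \<Rightarrow> 'a list \<Rightarrow> 'a \<Rightarrow> (bool \<times> nat) list set" where
  "lift_elt G gs g = (SOME Y. Y \<in> carrier (Gstar G gs) \<and> proj G gs Y = g)"

definition AutM :: "('a, 'b) monoid_scheme \<Rightarrow> 'a list \<Rightarrow> ((bool \<times> nat) list set \<Rightarrow> (bool \<times> nat) list set) set" where
  "AutM G gs = {\<alpha> \<in> auto (Gstar G gs). \<alpha> ` Mset G gs = Mset G gs}"

definition AutM_group where
  "AutM_group G gs = (AutoGroup (Gstar G gs))\<lparr>carrier := AutM G gs\<rparr>"

definition eta_G :: "('a, 'b) monoid_scheme \<Rightarrow> 'a list
    \<Rightarrow> ((bool \<times> nat) list set \<Rightarrow> (bool \<times> nat) list set) \<Rightarrow> 'a \<Rightarrow> 'a" where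
  "eta_G G gs \<alpha> = (\<lambda>g \<in> carrier G. proj G gs (\<alpha> (lift_elt G gs g)))"

definition eta_M :: "('a, 'b) monoid_scheme \<Rightarrow> 'a list
    \<Rightarrow> ((bool \<times> nat) list set \<Rightarrow> (bool \<times> nat) list set) \<Rightarrow> ((bool \<times> nat) list set \<Rightarrow> (bool \<times> nat) list set)" where
  "eta_M G gs \<alpha> = restrict \<alpha> (Mset G gs)"

definition Wset where
  "Wset G gs = {\<alpha> \<in> AutM G gs. eta_G G gs \<alpha> = (\<lambda>g \<in> carrier G. g)}"

definition Vset where
  "Vset G gs = {\<alpha> \<in> Wset G gs. eta_M G gs \<alpha> = (\<lambda>x \<in> Mset G gs. x)}"

definition Mgroup :: "('a, 'b) monoid_scheme \<Rightarrow> 'a list \<Rightarrow> (bool \<times> nat) list set monoid" where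
  "Mgroup G gs = (Gstar G gs)\<lparr>carrier := Mset G gs\<rparr>"

text \<open>gamma(g) = conjugation by any preimage of g in G*.\<close>

definition gam :: "('a, 'b) monoid_scheme \<Rightarrow> 'a list \<Rightarrow> 'a
    \<Rightarrow> (bool \<times> nat) list set \<Rightarrow> (bool \<times> nat) list set" where
  "gam G gs g = (\<lambda>m \<in> Mset G gs. lift_elt G gs g \<otimes>\<^bsub>Gstar G gs\<^esub> m
                    \<otimes>\<^bsub>Gstar G gs\<^esub> inv\<^bsub>Gstar G gs\<^esub> (lift_elt G gs g))"

definition Cset where
  "Cset G gs = {c \<in> auto (Mgroup G gs).
      \<forall>g \<in> carrier G. compose (Mset G gs) c (gam G gs g) = compose (Mset G gs) (gam G gs g) c}"

definition B2 where
  "B2 G gs = {(\<lambda>(g, h) \<in> carrier G \<times> carrier G.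
                 gam G gs g (t h) \<otimes>\<^bsub>Gstar G gs\<^esub> inv\<^bsub>Gstar G gs\<^esub> (t (g \<otimes>\<^bsub>G\<^esub> h))
                   \<otimes>\<^bsub>Gstar G gs\<^esub> t g) | t. t \<in> carrier G \<rightarrow>\<^sub>E Mset G gs}"

definition H2class where
  "H2class G gs \<delta> = {(\<lambda>p \<in> carrier G \<times> carrier G. \<delta> p \<otimes>\<^bsub>Gstar G gs\<^esub> \<beta> p) | \<beta>. \<beta> \<in> B2 G gs}"

definition act_C where
  "act_C G c \<delta> = (\<lambda>p \<in> carrier G \<times> carrier G. c (\<delta> p))"

definition Stab_C where
  "Stab_C G gs \<delta> = {c \<in> Cset G gs. H2class G gs (act_C G c \<delta>) = H2class G gs \<delta>}"

text \<open>The cocycle defining G* as an extension of M by G, coming from a section s : G -> G*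
  (s(g) s(h) = eps(g,h) s(gh)).\<close>

definition eps_of where
  "eps_of G gs s = (\<lambda>(g, h) \<in> carrier G \<times> carrier G.
      s g \<otimes>\<^bsub>Gstar G gs\<^esub> s h \<otimes>\<^bsub>Gstar G gs\<^esub> inv\<^bsub>Gstar G gs\<^esub> (s (g \<otimes>\<^bsub>G\<^esub> h)))"

definition Z1 where
  "Z1 G gs = {f \<in> carrier G \<rightarrow>\<^sub>E Mset G gs.
      \<forall>g \<in> carrier G. \<forall>h \<in> carrier G. f (g \<otimes>\<^bsub>G\<^esub> h) = f g \<otimes>\<^bsub>Gstar G gs\<^esub> gam G gs g (f h)}"

definition Z1_group where
  "Z1_group G gs = \<lparr>carrier = Z1 G gs,
      monoid.mult = (\<lambda>f f'. \<lambda>g \<in> carrier G. f g \<otimes>\<^bsub>Gstar G gs\<^esub> f' g),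
      one = (\<lambda>g \<in> carrier G. \<one>\<^bsub>Gstar G gs\<^esub>)\<rparr>"

end

theory Submission
  imports Defs
begin

text \<open>
  To lift an automorphism \<open>\<theta>\<close> of \<open>G\<close> to \<open>G*\<close>, note first that \<open>G*\<close> is finite, its subgroup \<open>M\<close> being
  abelian of exponent dividing \<open>k\<close> and finitely generated by Schreier's lemma. By Gaschuetz's lemma
  the tuple \<open>\<theta>(g\<^sub>1), \<dots>, \<theta>(g\<^sub>n)\<close> then lifts to a tuple generating \<open>G*\<close>. Mapping the free generators to
  it gives an epimorphism from the free group onto \<open>G*\<close>; as the Fitting subgroup is characteristic, this map
  kills \<open>[R,L]R\<^sup>k\<close>, so it induces a surjective, hence bijective, endomorphism of \<open>G*\<close> over \<open>\<theta>\<close>.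

  For a section \<open>s\<close>, every element of \<open>G*\<close> is uniquely \<open>m s(g)\<close>, and the elements of \<open>W\<close> are exactly the maps
  \<open>m s(g) \<mapsto> c(m) t(g) s(g)\<close> where \<open>c \<in> C\<close> and \<open>c(\<epsilon>) - \<epsilon>\<close> is the coboundary of \<open>t\<close>; the case \<open>c = 1\<close>
  identifies \<open>V\<close> with \<open>Z\<^sup>1(G,M)\<close>.
\<close>

section \<open>Free groups on reduced words\<close>

lemma letter_inv_letter_inv [simp]: "letter_inv (letter_inv x) = x"
  by (simp add: letter_inv_def)

lemma snd_letter_inv [simp]: "snd (letter_inv x) = snd x"
  by (simp add: letter_inv_def)

lemma reduced_word_ConsD: "reduced_word (x # w) \<Longrightarrow> reduced_word w"
  by (cases w) auto

lemma reduced_word_cons_red: "reduced_word w \<Longrightarrow> reduced_word (cons_red x w)"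
  by (cases w) (auto simp: cons_red_def dest: reduced_word_ConsD)

text \<open>Reducedness rules out a second cancellation: if \<open>x\<close> cancels against the
  head of \<open>w\<close>, the next letter of \<open>w\<close> is not \<open>x\<close>, so the
  inverse letter is simply put back.\<close>

lemma cons_red_letter_inv:
  "reduced_word w \<Longrightarrow> cons_red (letter_inv x) (cons_red x w) = w"
  by (cases w rule: reduced_word.cases) (auto simp: cons_red_def)

lemma reduced_word_foldr: "reduced_word w \<Longrightarrow> reduced_word (foldr cons_red v w)"
  by (induction v) (auto intro: reduced_word_cons_red)

lemma foldr_cons_red_cons_red:
  assumes "reduced_word w"
  shows "foldr cons_red (cons_red x v) w = cons_red x (foldr cons_red v w)"
proof (cases v)
  case (Cons y u)
  then show ?thesis
    using cons_red_letter_inv[of "foldr cons_red u w" "letter_inv x"] assms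
    by (auto simp: cons_red_def[of x "y # u"] reduced_word_foldr)
qed (simp add: cons_red_def)

lemma foldr_cons_red_assoc:
  "reduced_word w \<Longrightarrow>
    foldr cons_red (foldr cons_red u v) w = foldr cons_red u (foldr cons_red v w)"
  by (induction u) (auto simp: foldr_cons_red_cons_red)

lemma foldr_cons_red_Nil: "reduced_word w \<Longrightarrow> foldr cons_red w [] = w"
  by (induction w rule: reduced_word.induct) (auto simp: cons_red_def)

lemma foldr_cons_red_inverse:
  "reduced_word w \<Longrightarrow>
    foldr cons_red (rev (map letter_inv v)) (foldr cons_red v w) = w"
  by (induction v arbitrary: w) (auto simp: cons_red_letter_inv reduced_word_foldr)

lemma set_cons_red_subset: "set (cons_red x w) \<subseteq> insert x (set w)"
  by (auto simp: cons_red_def split: list.splits if_splits)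

lemma set_foldr_cons_red_subset: "set (foldr cons_red v w) \<subseteq> set v \<union> set w"
  by (induction v) (use set_cons_red_subset in fastforce)+

lemma carrier_free_group:
  "w \<in> carrier (free_group n) \<longleftrightarrow> reduced_word w \<and> (\<forall>x\<in>set w. snd x < n)"
  by (simp add: free_group_def)

lemma mult_free_group: "v \<otimes>\<^bsub>free_group n\<^esub> w = foldr cons_red v w"
  by (simp add: free_group_def)

lemma one_free_group: "\<one>\<^bsub>free_group n\<^esub> = []"
  by (simp add: free_group_def)

lemma group_free_group: "group (free_group n)"
proof (rule groupI)
  fix x y assume "x \<in> carrier (free_group n)" "y \<in> carrier (free_group n)"
  then show "x \<otimes>\<^bsub>free_group n\<^esub> y \<in> carrier (free_group n)"
    using set_foldr_cons_red_subset[of x y]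
    by (auto simp: carrier_free_group mult_free_group reduced_word_foldr)
next
  fix x assume x: "x \<in> carrier (free_group n)"
  \<comment> \<open>Folding the reversed inverse letters onto the empty word makes the candidate
    inverse reduced by construction.\<close>
  let ?y = "foldr cons_red (rev (map letter_inv x)) []"
  have "?y \<otimes>\<^bsub>free_group n\<^esub> x = []"
    using x foldr_cons_red_inverse[of "[]" x] foldr_cons_red_Nil[of x]
    by (simp add: mult_free_group foldr_cons_red_assoc carrier_free_group)
  moreover have "?y \<in> carrier (free_group n)"
    using x set_foldr_cons_red_subset[of "rev (map letter_inv x)" "[]"]
    by (force simp: carrier_free_group reduced_word_foldr)
  ultimately show "\<exists>y\<in>carrier (free_group n). y \<otimes>\<^bsub>free_group n\<^esub> x = \<one>\<^bsub>free_group n\<^esub>"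
    by (auto simp: one_free_group)
qed (auto simp: mult_free_group one_free_group carrier_free_group foldr_cons_red_assoc)

section \<open>Evaluation of words at a tuple of group elements\<close>

definition letter_val :: "('a, 'b) monoid_scheme \<Rightarrow> 'a list \<Rightarrow> bool \<times> nat \<Rightarrow> 'a" where
  "letter_val G gs x = (if fst x then gs ! snd x else inv\<^bsub>G\<^esub> (gs ! snd x))"

lemma free_lift_Nil [simp]: "free_lift G gs [] = \<one>\<^bsub>G\<^esub>"
  by (simp add: free_lift_def)

lemma free_lift_Cons [simp]:
  "free_lift G gs (x # w) = letter_val G gs x \<otimes>\<^bsub>G\<^esub> free_lift G gs w"
  by (simp add: free_lift_def letter_val_def)

context group
begin

lemma letter_val_closed:
  "set gs \<subseteq> carrier G \<Longrightarrow> snd x < length gs \<Longrightarrow> letter_val G gs x \<in> carrier G"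
  by (auto simp: letter_val_def subset_iff)

lemma letter_val_letter_inv:
  assumes "set gs \<subseteq> carrier G" "snd x < length gs"
  shows "letter_val G gs (letter_inv x) = inv (letter_val G gs x)"
proof -
  have "gs ! snd x \<in> carrier G" using assms by auto
  then show ?thesis by (auto simp: letter_val_def letter_inv_def)
qed

lemma free_lift_closed:
  "set gs \<subseteq> carrier G \<Longrightarrow> \<forall>x\<in>set w. snd x < length gs \<Longrightarrow> free_lift G gs w \<in> carrier G"
  by (induction w) (auto intro: letter_val_closed)

lemma free_lift_cons_red:
  assumes "set gs \<subseteq> carrier G" "snd x < length gs" "\<forall>y\<in>set w. snd y < length gs"
  shows "free_lift G gs (cons_red x w) = letter_val G gs x \<otimes> free_lift G gs w"
proof (cases w)
  case (Cons y u)
  have "letter_val G gs x \<otimes> (inv (letter_val G gs x) \<otimes> free_lift G gs u) = free_lift G gs u"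
    using assms Cons by (simp add: letter_val_closed free_lift_closed flip: m_assoc)
  then show ?thesis
    using assms Cons by (auto simp: cons_red_def letter_val_letter_inv)
qed (simp add: cons_red_def)

lemma free_lift_hom:
  assumes "set gs \<subseteq> carrier G"
  shows "free_lift G gs \<in> hom (FreeG gs) G"
proof (rule homI)
  fix v w assume "v \<in> carrier (FreeG gs)" "w \<in> carrier (FreeG gs)"
  then have "\<forall>x\<in>set v. snd x < length gs" "\<forall>x\<in>set w. snd x < length gs"
    by (auto simp: carrier_free_group)
  then show "free_lift G gs (v \<otimes>\<^bsub>FreeG gs\<^esub> w) = free_lift G gs v \<otimes> free_lift G gs w"
  proof (induction v)
    case (Cons x v)
    have "\<forall>y\<in>set (foldr cons_red v w). snd y < length gs"
      using set_foldr_cons_red_subset[of v w] Cons.prems by auto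
    then show ?case
      using Cons assms
      by (simp add: mult_free_group free_lift_cons_red m_assoc letter_val_closed free_lift_closed)
  qed (use assms in \<open>simp add: mult_free_group free_lift_closed\<close>)
qed (use assms in \<open>auto simp: carrier_free_group free_lift_closed\<close>)

lemma free_lift_image:
  assumes gs: "set gs \<subseteq> carrier G"
  shows "free_lift G gs ` carrier (FreeG gs) = generate G (set gs)"
proof
  interpret h: group_hom "FreeG gs" G "free_lift G gs"
    using free_lift_hom[OF gs] group_free_group is_group
    by (simp add: group_hom_def group_hom_axioms_def)
  show "generate G (set gs) \<subseteq> free_lift G gs ` carrier (FreeG gs)"
  proof (rule generate_subgroup_incl[OF _ h.img_is_subgroup])
    have "gs ! i \<in> free_lift G gs ` carrier (FreeG gs)" if "i < length gs" for i
      using that gs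
      by (intro image_eqI[of _ _ "[(True, i)]"]) (auto simp: carrier_free_group letter_val_def subset_iff)
    then show "set gs \<subseteq> free_lift G gs ` carrier (FreeG gs)"
      by (auto simp: in_set_conv_nth)
  qed
  have "free_lift G gs w \<in> generate G (set gs)" if "\<forall>x\<in>set w. snd x < length gs" for w
    using that
  proof (induction w)
    case (Cons x w)
    then have "letter_val G gs x \<in> generate G (set gs)"
      by (auto simp: letter_val_def intro: generate.incl generate.inv)
    then show ?case using Cons by (auto intro: generate.eng)
  qed (auto intro: generate.one)
  then show "free_lift G gs ` carrier (FreeG gs) \<subseteq> generate G (set gs)"
    by (auto simp: carrier_free_group)
qed

end

lemma (in group_hom) hom_free_lift:
  assumes "set gs \<subseteq> carrier G" "\<forall>x\<in>set w. snd x < length gs"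
  shows "h (free_lift G gs w) = free_lift H (map h gs) w"
  using assms(2)
proof (induction w)
  case (Cons x w)
  moreover have "gs ! snd x \<in> carrier G" using assms(1) Cons.prems by auto
  ultimately show ?case
    using assms(1) by (auto simp: letter_val_def G.free_lift_closed)
qed auto

definition free_gens :: "nat \<Rightarrow> (bool \<times> nat) list list" where
  "free_gens n = map (\<lambda>i. [(True, i)]) [0..<n]"

lemma free_gens_closed: "set (free_gens n) \<subseteq> carrier (free_group n)"
  by (auto simp: free_gens_def carrier_free_group)

lemma length_free_gens [simp]: "length (free_gens n) = n"
  by (simp add: free_gens_def)

text \<open>Evaluation at the one-letter words multiplies the letters of \<open>w\<close> back
  together, and a reduced word survives this unchanged. Hence any homomorphism out of the free group
  can be written as an evaluation map.\<close>

lemma free_lift_free_gens: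
  assumes "w \<in> carrier (free_group n)"
  shows "free_lift (free_group n) (free_gens n) w = w"
proof -
  interpret group "free_group n" by (rule group_free_group)
  have val: "letter_val (free_group n) (free_gens n) x = [x]" if "snd x < n" for x
  proof -
    have "inv\<^bsub>free_group n\<^esub> [(True, i)] = [(False, i)]" if "i < n" for i
      using that by (intro inv_equality)
        (auto simp: mult_free_group one_free_group carrier_free_group cons_red_def letter_inv_def)
    then show ?thesis using that
      by (cases x) (auto simp: letter_val_def free_gens_def)
  qed
  have "free_lift (free_group n) (free_gens n) w = foldr cons_red w []"
    if "\<forall>x\<in>set w. snd x < n"
    using that by (induction w) (auto simp: val mult_free_group one_free_group)
  then show ?thesis
    using assms by (simp add: carrier_free_group foldr_cons_red_Nil)
qed


section \<open>Lifting generating tuples\<close>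

context group_hom
begin

text \<open>Right translation by the inverse of one point of the fibre maps it bijectively onto the
  part of the kernel inside \<open>K\<close>.\<close>

lemma card_fibre_eq_card_kernel:
  assumes K: "subgroup K G" and y: "y \<in> h ` K"
  shows "card {x \<in> K. h x = y} = card {x \<in> K. h x = \<one>\<^bsub>H\<^esub>}"
proof -
  interpret K: subgroup K G by (rule K)
  from y obtain z where z: "z \<in> K" "h z = y" by auto
  then have yc: "y \<in> carrier H" by auto
  have "bij_betw (\<lambda>x. x \<otimes>\<^bsub>G\<^esub> inv\<^bsub>G\<^esub> z) {x \<in> K. h x = y} {x \<in> K. h x = \<one>\<^bsub>H\<^esub>}"
    by (rule bij_betwI[where g = "\<lambda>x. x \<otimes>\<^bsub>G\<^esub> z"]) (use z yc in \<open>auto simp: G.m_assoc\<close>)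
  then show ?thesis by (rule bij_betw_same_card)
qed

text \<open>The entries of a lift are chosen independently, each in a fibre of the same size. The
  count therefore depends on the tuple only through its length.\<close>

lemma card_lifts:
  assumes K: "subgroup K G" and fin: "finite K" and hs: "set hs \<subseteq> h ` K"
  shows "finite {xs. set xs \<subseteq> K \<and> map h xs = hs} \<and>
    card {xs. set xs \<subseteq> K \<and> map h xs = hs} = card {x \<in> K. h x = \<one>\<^bsub>H\<^esub>} ^ length hs"
  using hs
proof (induction hs)
  case Nil
  have "{xs. set xs \<subseteq> K \<and> map h xs = []} = {[]}" by auto
  then show ?case by simp
next
  case (Cons y hs)
  have "{xs. set xs \<subseteq> K \<and> map h xs = y # hs} =
      (\<lambda>(x, xs). x # xs) ` ({x \<in> K. h x = y} \<times> {xs. set xs \<subseteq> K \<and> map h xs = hs})"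
    by (auto simp: map_eq_Cons_conv image_iff)
  moreover have "inj_on (\<lambda>(x, xs). x # xs) A" for A :: "('a \<times> 'a list) set"
    by (auto simp: inj_on_def)
  ultimately show ?case
    using Cons fin K by (auto simp: card_image card_cartesian_product card_fibre_eq_card_kernel)
qed

abbreviation generating_lifts :: "'c list \<Rightarrow> 'a set \<Rightarrow> 'a list set" where
  "generating_lifts hs K \<equiv>
    {xs. set xs \<subseteq> carrier G \<and> map h xs = hs \<and> generate G (set xs) = K}"

text \<open>Strong induction on the order of \<open>K\<close>. The lifts with entries in
  \<open>K\<close> are sorted by the subgroup that they generate; their total is the same for both
  tuples by \<open>card_lifts\<close>, and so are the terms for proper subgroups by induction, hence
  also the term for \<open>K\<close>.\<close>

lemma card_generating_lifts:
  assumes fin: "finite (carrier G)" and K: "subgroup K G"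
    and hs: "generate H (set hs) = carrier H" "set hs \<subseteq> carrier H"
    and hs': "generate H (set hs') = carrier H" "set hs' \<subseteq> carrier H"
    and len: "length hs = length hs'"
  shows "card (generating_lifts hs K) = card (generating_lifts hs' K)"
  using K
proof (induction "card K" arbitrary: K rule: less_induct)
  case less
  have finK: "finite K" and subK: "K \<subseteq> carrier G"
    using fin less.prems subgroup.subset finite_subset by blast+
  have image: "h ` K' = carrier H" if "xs \<in> generating_lifts us K'"
    and "generate H (set us) = carrier H" for xs us K'
    using that generate_img[of "set xs"] by auto
  show ?case
  proof (cases "h ` K = carrier H")
    \<comment> \<open>A lift of a generating tuple generates a subgroup that maps onto
      \<open>H\<close>, so in this case both sets are empty.\<close>
    case False
    then have "generating_lifts hs K = {}" "generating_lifts hs' K = {}"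
      using image hs hs' by blast+
    then show ?thesis by (simp only:)
  next
    case True
    let ?lifts = "\<lambda>us. {xs. set xs \<subseteq> K \<and> map h xs = us}"
    let ?P = "{K'. subgroup K' G \<and> K' \<subset> K}"
    have finP: "finite ?P"
      by (rule finite_subset[of _ "Pow K"]) (use finK in auto)
    have split: "card (?lifts us) =
        card (generating_lifts us K) + (\<Sum>K'\<in>?P. card (generating_lifts us K'))"
      if us: "set us \<subseteq> carrier H" for us
    proof -
      have fl: "finite (?lifts us)"
        using card_lifts[OF less.prems finK] us True by auto
      have sub: "generating_lifts us K' \<subseteq> ?lifts us" if "K' \<subseteq> K" for K'
        using that generate.incl by fastforce
      have "?lifts us = (\<Union>K'\<in>insert K ?P. generating_lifts us K')"
      proof
        show "?lifts us \<subseteq> (\<Union>K'\<in>insert K ?P. generating_lifts us K')"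
        proof
          fix xs assume xs: "xs \<in> ?lifts us"
          then have "generate G (set xs) \<subseteq> K" "subgroup (generate G (set xs)) G"
            using G.generate_subgroup_incl less.prems G.generate_is_subgroup subK by auto
          then show "xs \<in> (\<Union>K'\<in>insert K ?P. generating_lifts us K')"
            using xs subK by auto
        qed
        show "(\<Union>K'\<in>insert K ?P. generating_lifts us K') \<subseteq> ?lifts us"
          using sub by (intro UN_least) auto
      qed
      also have "card \<dots> = (\<Sum>K'\<in>insert K ?P. card (generating_lifts us K'))"
      proof (rule card_UN_disjoint)
        show "\<forall>K'\<in>insert K ?P. finite (generating_lifts us K')"
          using sub finite_subset[OF _ fl] by (metis (no_types, lifting) insert_iff mem_Collect_eq psubsetE subset_refl)
      qed (use finP in auto)
      also have "\<dots> = card (generating_lifts us K) + (\<Sum>K'\<in>?P. card (generating_lifts us K'))"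
        using finP by (subst sum.insert) auto
      finally show ?thesis .
    qed
    have "(\<Sum>K'\<in>?P. card (generating_lifts hs K')) = (\<Sum>K'\<in>?P. card (generating_lifts hs' K'))"
      by (rule sum.cong) (use less.hyps finK psubset_card_mono in blast)+
    moreover have "card (?lifts hs) = card (?lifts hs')"
      using card_lifts[OF less.prems finK, of hs] card_lifts[OF less.prems finK, of hs']
        True hs hs' len by simp
    ultimately show ?thesis
      using split[of hs] split[of hs'] hs hs' by simp
  qed
qed

text \<open>Gaschuetz's lemma: since the number of generating lifts does not depend on the generating
  tuple, one tuple with a generating lift is enough.\<close>

lemma generating_tuple_lift:
  assumes fin: "finite (carrier G)"
    and xs: "set xs \<subseteq> carrier G" "generate G (set xs) = carrier G"
    and surj: "h ` carrier G = carrier H"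
    and hs: "set hs \<subseteq> carrier H" "generate H (set hs) = carrier H" "length hs = length xs"
  obtains ys where "set ys \<subseteq> carrier G" "map h ys = hs" "generate G (set ys) = carrier G"
proof -
  have fl: "finite (generating_lifts (map h xs) (carrier G))"
    by (rule finite_subset[OF _ conjunct1[OF card_lifts[OF G.subgroup_self fin, of "map h xs"]]])
      (use xs(1) in auto)
  have "generate H (set (map h xs)) = carrier H"
    using generate_img[OF xs(1)] xs(2) surj by simp
  then have "card (generating_lifts hs (carrier G)) =
      card (generating_lifts (map h xs) (carrier G))"
    using xs hs hom_closed by (intro card_generating_lifts[OF fin G.subgroup_self]) auto
  \<comment> \<open>The tuple \<open>xs\<close> is a generating lift of its own image, which makes
    this count, and therefore the count for \<open>hs\<close>, positive.\<close>
  moreover have "xs \<in> generating_lifts (map h xs) (carrier G)"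
    using xs by simp
  then have "card (generating_lifts (map h xs) (carrier G)) > 0"
    using fl by (simp only: card_gt_0_iff) blast
  ultimately have "card (generating_lifts hs (carrier G)) > 0" by (simp only:)
  then have "generating_lifts hs (carrier G) \<noteq> {}"
    unfolding card_gt_0_iff by (rule conjunct1)
  then obtain ys where "ys \<in> generating_lifts hs (carrier G)" by (meson ex_in_conv)
  then show thesis using that by blast
qed

end

section \<open>Finiteness of extensions\<close>

lemma (in group) finite_generate_single:
  assumes a: "a \<in> carrier G" and k: "(k::nat) > 0" "a [^] k = \<one>"
  shows "finite (generate G {a})"
proof -
  have "a [^] z = a [^] (z mod int k)" for z :: int
  proof -
    have "a [^] z = a [^] (int k * (z div int k) + z mod int k)" by simp
    also have "\<dots> = (a [^] int k) [^] (z div int k) \<otimes> a [^] (z mod int k)"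
      using a by (simp only: int_pow_mult int_pow_pow)
    also have "a [^] int k = \<one>" using k by (simp add: int_pow_int)
    finally show ?thesis using a by simp
  qed
  then have "generate G {a} \<subseteq> (\<lambda>z. a [^] z) ` {0..<int k}"
    using a k by (auto simp: generate_pow)
       (metis atLeastLessThan_iff image_eqI of_nat_0_less_iff pos_mod_bound pos_mod_sign)
  then show ?thesis by (rule finite_subset) simp
qed

text \<open>Each new generator contributes a finite cyclic factor: in an abelian group the product
  set of two subgroups is again a subgroup, and it is finite if both factors are.\<close>

lemma (in comm_group) finite_generate_torsion:
  assumes "finite S" "S \<subseteq> carrier G" and k: "(k::nat) > 0" and tors: "\<And>a. a \<in> S \<Longrightarrow> a [^] k = \<one>"
  shows "finite (generate G S)"
  using assms(1,2) tors
proof (induction S)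
  case empty
  show ?case by (simp add: generate_empty)
next
  case (insert a S)
  let ?A = "generate G {a}" and ?B = "generate G S"
  have A: "subgroup ?A G" and B: "subgroup ?B G"
    using insert.prems by (auto intro: generate_is_subgroup)
  have "finite ?A" using insert.prems k by (auto intro: finite_generate_single)
  moreover have "finite ?B" using insert by auto
  ultimately have fin: "finite (?A <#> ?B)" by (auto simp: set_mult_def)
  have sub: "subgroup (?A <#> ?B) G"
    by (rule mult_subgroups[OF A B])
  have "a = a \<otimes> \<one>" "\<And>b. b \<in> S \<Longrightarrow> b = \<one> \<otimes> b"
    using insert.prems by auto
  then have "insert a S \<subseteq> ?A <#> ?B"
    unfolding set_mult_def using generate.incl[of _ _ G] generate.one[of G] by blast
  from generate_subgroup_incl[OF this sub] show ?case
    using fin by (rule finite_subset)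
qed

text \<open>Schreier's argument: for a section \<open>s\<close>, the elements \<open>s(h(x)y)\<^sup>-\<^sup>1 x s(y)\<close> with \<open>x\<close> a
  generator generate a subgroup \<open>N\<close> of the kernel such that \<open>s(H)N\<close> is the whole group.\<close>

lemma (in group_hom) finite_extension_torsion_kernel:
  assumes S: "finite S" "S \<subseteq> carrier G" "generate G S = carrier G"
    and finH: "finite (carrier H)" and surj: "h ` carrier G = carrier H"
    and comm: "\<And>x y. x \<in> kernel G H h \<Longrightarrow> y \<in> kernel G H h \<Longrightarrow> x \<otimes>\<^bsub>G\<^esub> y = y \<otimes>\<^bsub>G\<^esub> x"
    and k: "(k::nat) > 0" and tors: "\<And>x. x \<in> kernel G H h \<Longrightarrow> x [^]\<^bsub>G\<^esub> k = \<one>\<^bsub>G\<^esub>"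
  shows "finite (carrier G)"
proof -
  let ?M = "kernel G H h"
  define s where "s = inv_into (carrier G) h"
  have s: "s y \<in> carrier G" "h (s y) = y" if "y \<in> carrier H" for y
    using that surj by (auto simp: s_def inv_into_into f_inv_into_f)
  \<comment> \<open>Inverses are included so that the induction over \<open>generate\<close> below
    covers inverted generators as well.\<close>
  define Y where "Y = S \<union> m_inv G ` S"
  \<comment> \<open>The Schreier elements. The section need not send identity to identity, so the
    inverse of its value there is added; this puts the identity of \<open>G\<close> into
    \<open>T\<close>.\<close>
  define D where "D = (\<lambda>(x, y). inv\<^bsub>G\<^esub> (s (h x \<otimes>\<^bsub>H\<^esub> y)) \<otimes>\<^bsub>G\<^esub> x \<otimes>\<^bsub>G\<^esub> s y) ` (Y \<times> carrier H)
    \<union> {inv\<^bsub>G\<^esub> (s \<one>\<^bsub>H\<^esub>)}"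
  have Y: "Y \<subseteq> carrier G" "finite Y" using S by (auto simp: Y_def)
  have finD: "finite D" using Y finH by (auto simp: D_def)
  have DM: "D \<subseteq> ?M" using Y s
    by (auto simp: D_def kernel_def subset_iff H.m_assoc H.inv_mult_group)
  interpret M: comm_group "G\<lparr>carrier := ?M\<rparr>"
    using comm by (intro group.group_comm_groupI)
      (auto intro: G.subgroup_imp_group subgroup_kernel)
  define N where "N = generate G D"
  have N: "subgroup N G" using DM by (auto simp: N_def kernel_def intro!: G.generate_is_subgroup)
  then interpret N: subgroup N G .
  have "x [^]\<^bsub>G\<lparr>carrier := ?M\<rparr>\<^esub> k = \<one>\<^bsub>G\<^esub>" if "x \<in> D" for x
    using that tors DM G.nat_pow_consistent[of x k ?M] by auto
  then have "finite (generate (G\<lparr>carrier := ?M\<rparr>) D)"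
    using M.finite_generate_torsion[OF finD _ k] DM by auto
  then have finN: "finite N"
    by (simp add: N_def G.generate_consistent[OF DM subgroup_kernel])
  define T where "T = (\<lambda>(y, z). s y \<otimes>\<^bsub>G\<^esub> z) ` (carrier H \<times> N)"
  have Y_T: "x \<otimes>\<^bsub>G\<^esub> t \<in> T" if "x \<in> Y" "t \<in> T" for x t
  proof -
    from that obtain y z where yz: "y \<in> carrier H" "z \<in> N" "t = s y \<otimes>\<^bsub>G\<^esub> z"
      by (auto simp: T_def)
    have x: "x \<in> carrier G" using that Y by auto
    let ?d = "inv\<^bsub>G\<^esub> (s (h x \<otimes>\<^bsub>H\<^esub> y)) \<otimes>\<^bsub>G\<^esub> x \<otimes>\<^bsub>G\<^esub> s y"
    have "?d \<in> N"
      unfolding N_def by (rule generate.incl) (use that yz in \<open>auto simp: D_def\<close>)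
    moreover have "x \<otimes>\<^bsub>G\<^esub> t = s (h x \<otimes>\<^bsub>H\<^esub> y) \<otimes>\<^bsub>G\<^esub> (?d \<otimes>\<^bsub>G\<^esub> z)"
      using x yz s by (simp add: G.m_assoc[symmetric])
    ultimately show ?thesis
      using x yz by (auto simp: T_def intro!: image_eqI[of _ _ "(h x \<otimes>\<^bsub>H\<^esub> y, ?d \<otimes>\<^bsub>G\<^esub> z)"])
  qed
  have T: "T \<subseteq> carrier G" using s by (auto simp: T_def)
  have gen_T: "\<forall>t\<in>T. x \<otimes>\<^bsub>G\<^esub> t \<in> T" if "x \<in> generate G S" for x
    using that
  proof induction
    case one
    then show ?case using T by auto
  next
    case (eng x y)
    then have "x \<in> carrier G" "y \<in> carrier G" using S(3) by auto
    then show ?case using eng T by (auto simp: G.m_assoc subset_iff)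
  qed (auto simp: Y_def intro!: Y_T)
  have "inv\<^bsub>G\<^esub> (s \<one>\<^bsub>H\<^esub>) \<in> N"
    unfolding N_def by (rule generate.incl) (simp add: D_def)
  then have "\<one>\<^bsub>G\<^esub> \<in> T"
    using s[of "\<one>\<^bsub>H\<^esub>"] by (auto simp: T_def intro!: image_eqI[of _ _ "(\<one>\<^bsub>H\<^esub>, inv\<^bsub>G\<^esub> (s \<one>\<^bsub>H\<^esub>))"])
  then have "carrier G \<subseteq> T" using gen_T S(3) by force
  moreover have "finite T" using finH finN by (auto simp: T_def)
  ultimately show ?thesis by (rule finite_subset)
qed

section \<open>The Fitting subgroup is characteristic\<close>

lemma (in group_hom) comm_subgroup_img:
  assumes "A \<subseteq> carrier G" "B \<subseteq> carrier G"
  shows "comm_subgroup H (h ` A) (h ` B) = h ` comm_subgroup G A B"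
proof -
  let ?S = "{a \<otimes>\<^bsub>G\<^esub> b \<otimes>\<^bsub>G\<^esub> inv\<^bsub>G\<^esub> a \<otimes>\<^bsub>G\<^esub> inv\<^bsub>G\<^esub> b | a b. a \<in> A \<and> b \<in> B}"
  have "h ` ?S = {a \<otimes>\<^bsub>H\<^esub> b \<otimes>\<^bsub>H\<^esub> inv\<^bsub>H\<^esub> a \<otimes>\<^bsub>H\<^esub> inv\<^bsub>H\<^esub> b | a b. a \<in> h ` A \<and> b \<in> h ` B}"
  proof -
    have eq: "h (a \<otimes>\<^bsub>G\<^esub> b \<otimes>\<^bsub>G\<^esub> inv\<^bsub>G\<^esub> a \<otimes>\<^bsub>G\<^esub> inv\<^bsub>G\<^esub> b) = h a \<otimes>\<^bsub>H\<^esub> h b \<otimes>\<^bsub>H\<^esub> inv\<^bsub>H\<^esub> h a \<otimes>\<^bsub>H\<^esub> inv\<^bsub>H\<^esub> h b"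
      if "a \<in> A" "b \<in> B" for a b
    proof -
      have "a \<in> carrier G" "b \<in> carrier G" using that assms by auto
      then show ?thesis by simp
    qed
    show ?thesis
    proof (intro equalityI subsetI)
      fix x assume "x \<in> h ` ?S"
      then obtain a b where "a \<in> A" "b \<in> B" "x = h (a \<otimes>\<^bsub>G\<^esub> b \<otimes>\<^bsub>G\<^esub> inv\<^bsub>G\<^esub> a \<otimes>\<^bsub>G\<^esub> inv\<^bsub>G\<^esub> b)" by auto
      then show "x \<in> {a \<otimes>\<^bsub>H\<^esub> b \<otimes>\<^bsub>H\<^esub> inv\<^bsub>H\<^esub> a \<otimes>\<^bsub>H\<^esub> inv\<^bsub>H\<^esub> b | a b. a \<in> h ` A \<and> b \<in> h ` B}"
        using eq by auto
    next
      fix x assume "x \<in> {a \<otimes>\<^bsub>H\<^esub> b \<otimes>\<^bsub>H\<^esub> inv\<^bsub>H\<^esub> a \<otimes>\<^bsub>H\<^esub> inv\<^bsub>H\<^esub> b | a b. a \<in> h ` A \<and> b \<in> h ` B}"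
      then obtain a b where "a \<in> A" "b \<in> B" "x = h a \<otimes>\<^bsub>H\<^esub> h b \<otimes>\<^bsub>H\<^esub> inv\<^bsub>H\<^esub> h a \<otimes>\<^bsub>H\<^esub> inv\<^bsub>H\<^esub> h b" by auto
      then have "x = h (a \<otimes>\<^bsub>G\<^esub> b \<otimes>\<^bsub>G\<^esub> inv\<^bsub>G\<^esub> a \<otimes>\<^bsub>G\<^esub> inv\<^bsub>G\<^esub> b)" using eq by simp
      then show "x \<in> h ` ?S" using \<open>a \<in> A\<close> \<open>b \<in> B\<close> by blast
    qed
  qed
  moreover have "?S \<subseteq> carrier G" using assms by (auto simp: subset_iff)
  ultimately show ?thesis
    using generate_img[of ?S] by (simp add: comm_subgroup_def)
qed

lemma (in group) comm_subgroup_closed: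
  assumes "A \<subseteq> carrier G" "B \<subseteq> carrier G"
  shows "comm_subgroup G A B \<subseteq> carrier G"
  unfolding comm_subgroup_def by (rule generate_incl) (use assms in \<open>auto simp: subset_iff\<close>)

lemma (in group) lower_central_closed:
  "N \<subseteq> carrier G \<Longrightarrow> lower_central G N i \<subseteq> carrier G"
  by (induction i) (auto dest: comm_subgroup_closed)

lemma (in group_hom) lower_central_img:
  "N \<subseteq> carrier G \<Longrightarrow> lower_central H (h ` N) i = h ` lower_central G N i"
  by (induction i) (auto simp: comm_subgroup_img G.lower_central_closed)

lemma (in group_hom) normal_img:
  assumes "N \<lhd> G" "h ` carrier G = carrier H"
  shows "h ` N \<lhd> H"
  unfolding H.normal_inv_iff
proof (intro conjI ballI)
  have N: "subgroup N G" using assms(1) by (rule normal_imp_subgroup)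
  then show "subgroup (h ` N) H" by (rule subgroup_img_is_subgroup)
  fix y n assume "y \<in> carrier H" "n \<in> h ` N"
  then obtain x m where x: "x \<in> carrier G" "y = h x" and m: "m \<in> N" "n = h m"
    using assms(2) by (metis imageE)
  then have "h (x \<otimes>\<^bsub>G\<^esub> m \<otimes>\<^bsub>G\<^esub> inv\<^bsub>G\<^esub> x) = y \<otimes>\<^bsub>H\<^esub> n \<otimes>\<^bsub>H\<^esub> inv\<^bsub>H\<^esub> y"
    using N subgroup.mem_carrier by fastforce
  moreover have "x \<otimes>\<^bsub>G\<^esub> m \<otimes>\<^bsub>G\<^esub> inv\<^bsub>G\<^esub> x \<in> N"
    using assms(1) x m by (simp add: normal.inv_op_closed2)
  ultimately show "y \<otimes>\<^bsub>H\<^esub> n \<otimes>\<^bsub>H\<^esub> inv\<^bsub>H\<^esub> y \<in> h ` N" by (metis imageI)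
qed

text \<open>Surjectivity makes images of normal subgroups normal, and lower central series map to
  lower central series. So the generators of one Fitting subgroup land among those of the
  other.\<close>

lemma (in group_hom) fitting_img:
  assumes surj: "h ` carrier G = carrier H"
  shows "h ` fitting G \<subseteq> fitting H"
proof -
  let ?U = "\<Union>{N. N \<lhd> G \<and> nilpotent_subgroup G N}"
  have sub: "?U \<subseteq> carrier G"
    using subgroup.subset normal_imp_subgroup by fastforce
  have "h ` N \<lhd> H \<and> nilpotent_subgroup H (h ` N)" if "N \<lhd> G" "nilpotent_subgroup G N" for N
  proof -
    have N: "subgroup N G" using that(1) by (rule normal_imp_subgroup)
    from that(2) obtain c where "lower_central G N c = {\<one>\<^bsub>G\<^esub>}"
      by (auto simp: nilpotent_subgroup_def)
    then have "lower_central H (h ` N) c = {\<one>\<^bsub>H\<^esub>}"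
      using lower_central_img[of N c] subgroup.subset[OF N] by simp
    then show ?thesis
      using normal_img[OF that(1) surj] by (auto simp: nilpotent_subgroup_def normal_imp_subgroup)
  qed
  then have "h ` ?U \<subseteq> \<Union>{N. N \<lhd> H \<and> nilpotent_subgroup H N}" by blast
  then show ?thesis
    unfolding fitting_def generate_img[OF sub, symmetric] by (rule H.mono_generate)
qed

text \<open>The generating union is closed under conjugation. This makes the preimage
  \<open>L\<close> of the Fitting subgroup stable under conjugation in the free group.\<close>

lemma (in group) fitting_normal: "fitting G \<lhd> G"
  unfolding fitting_def
proof (rule normal_generateI)
  show "\<Union>{N. N \<lhd> G \<and> nilpotent_subgroup G N} \<subseteq> carrier G"
    using subgroup.subset normal_imp_subgroup by fastforce
  fix x g assume "x \<in> \<Union>{N. N \<lhd> G \<and> nilpotent_subgroup G N}" and g: "g \<in> carrier G"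
  then obtain N where N: "N \<lhd> G" "nilpotent_subgroup G N" "x \<in> N" by auto
  then have "g \<otimes> x \<otimes> inv g \<in> N" using g by (simp add: normal.inv_op_closed2)
  then show "g \<otimes> x \<otimes> inv g \<in> \<Union>{N. N \<lhd> G \<and> nilpotent_subgroup G N}"
    using N by blast
qed


section \<open>The covering group\<close>

context group
begin

lemma inv_cancel_left: "x \<in> carrier G \<Longrightarrow> y \<in> carrier G \<Longrightarrow> inv x \<otimes> (x \<otimes> y) = y"
  by (simp flip: m_assoc)

lemma inv_cancel_right: "x \<in> carrier G \<Longrightarrow> y \<in> carrier G \<Longrightarrow> x \<otimes> (inv x \<otimes> y) = y"
  by (simp flip: m_assoc)

lemma conjugation_group_hom:
  assumes "g \<in> carrier G"
  shows "group_hom G G (\<lambda>x. g \<otimes> x \<otimes> inv g)"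
  by unfold_locales (use assms in \<open>auto intro!: homI simp: m_assoc inv_cancel_left\<close>)

lemma commutator_eq_one_imp_commute:
  assumes "x \<in> carrier G" "y \<in> carrier G" "x \<otimes> y \<otimes> inv x \<otimes> inv y = \<one>"
  shows "x \<otimes> y = y \<otimes> x"
proof -
  have "x \<otimes> y = x \<otimes> y \<otimes> inv x \<otimes> inv y \<otimes> (y \<otimes> x)"
    using assms(1,2) by (simp add: m_assoc inv_cancel_left)
  also have "\<dots> = y \<otimes> x" using assms by simp
  finally show ?thesis .
qed

end

locale covering = group G for G :: "('a, 'b) monoid_scheme" (structure) +
  fixes gs :: "'a list"
  assumes finite_carrier: "finite (carrier G)"
    and gs_closed: "set gs \<subseteq> carrier G"
    and gs_generate: "generate G (set gs) = carrier G"
begin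

abbreviation "Fr \<equiv> FreeG gs"
abbreviation "E \<equiv> Gstar G gs"
abbreviation "M \<equiv> Mset G gs"
abbreviation "\<mu> \<equiv> free_lift G gs"
abbreviation "\<pi> \<equiv> proj G gs"
abbreviation "\<kappa> \<equiv> \<lambda>w. Kgrp G gs #>\<^bsub>Fr\<^esub> w"

lemma mu_group_hom: "group_hom Fr G \<mu>"
  using free_lift_hom[OF gs_closed] group_free_group is_group
  by (simp add: group_hom_def group_hom_axioms_def)

sublocale mu: group_hom Fr G \<mu>
  by (rule mu_group_hom)

lemma mu_surj: "\<mu> ` carrier Fr = carrier G"
  using free_lift_image[OF gs_closed] gs_generate by simp

lemma Rker_iff: "r \<in> Rker G gs \<longleftrightarrow> r \<in> carrier Fr \<and> \<mu> r = \<one>"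
  by (simp add: Rker_def kernel_def)

lemma Lpre_iff: "l \<in> Lpre G gs \<longleftrightarrow> l \<in> carrier Fr \<and> \<mu> l \<in> fitting G"
  by (simp add: Lpre_def)

lemma one_in_fitting: "\<one> \<in> fitting G"
  by (simp add: fitting_def generate.one)

lemma Kgrp_gens_closed:
  "{r \<otimes>\<^bsub>Fr\<^esub> l \<otimes>\<^bsub>Fr\<^esub> inv\<^bsub>Fr\<^esub> r \<otimes>\<^bsub>Fr\<^esub> inv\<^bsub>Fr\<^esub> l | r l. r \<in> Rker G gs \<and> l \<in> Lpre G gs}
    \<union> {r [^]\<^bsub>Fr\<^esub> F_k G | r. r \<in> Rker G gs} \<subseteq> Rker G gs"
proof -
  have "\<mu> r \<otimes> \<mu> l \<otimes> inv \<mu> r \<otimes> inv \<mu> l = \<one>" if "r \<in> Rker G gs" "l \<in> Lpre G gs" for r l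
    using that by (simp add: Rker_iff Lpre_iff)
  then show ?thesis by (auto simp: Rker_iff Lpre_iff mu.hom_nat_pow)
qed

lemma Kgrp_subset_Rker: "Kgrp G gs \<subseteq> Rker G gs"
  unfolding Kgrp_def using Kgrp_gens_closed
  by (rule mu.G.generate_subgroup_incl) (simp add: Rker_def mu.subgroup_kernel)

text \<open>Conjugation is an endomorphism that maps \<open>R\<close> into itself, as a kernel, and
  \<open>L\<close> into itself, as the preimage of a normal subgroup. It therefore sends each kind
  of generator to generators of the same kind.\<close>

lemma Kgrp_normal: "Kgrp G gs \<lhd> Fr"
  unfolding Kgrp_def
proof (rule mu.G.normal_generateI)
  fix x g assume x: "x \<in> {r \<otimes>\<^bsub>Fr\<^esub> l \<otimes>\<^bsub>Fr\<^esub> inv\<^bsub>Fr\<^esub> r \<otimes>\<^bsub>Fr\<^esub> inv\<^bsub>Fr\<^esub> l | r l. r \<in> Rker G gs \<and> l \<in> Lpre G gs}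
    \<union> {r [^]\<^bsub>Fr\<^esub> F_k G | r. r \<in> Rker G gs}" (is "_ \<in> ?A \<union> ?B") and g: "g \<in> carrier Fr"
  interpret c: group_hom Fr Fr "\<lambda>x. g \<otimes>\<^bsub>Fr\<^esub> x \<otimes>\<^bsub>Fr\<^esub> inv\<^bsub>Fr\<^esub> g"
    using g by (rule mu.G.conjugation_group_hom)
  let ?c = "\<lambda>x. g \<otimes>\<^bsub>Fr\<^esub> x \<otimes>\<^bsub>Fr\<^esub> inv\<^bsub>Fr\<^esub> g"
  have R: "?c r \<in> Rker G gs" if "r \<in> Rker G gs" for r
    using that g by (simp add: Rker_iff)
  have L: "?c l \<in> Lpre G gs" if "l \<in> Lpre G gs" for l
    using that g normal.inv_op_closed2[OF fitting_normal] by (simp add: Lpre_iff)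
  from x show "?c x \<in> ?A \<union> ?B"
  proof
    assume "x \<in> ?A"
    then obtain r l where rl: "r \<in> Rker G gs" "l \<in> Lpre G gs"
      "x = r \<otimes>\<^bsub>Fr\<^esub> l \<otimes>\<^bsub>Fr\<^esub> inv\<^bsub>Fr\<^esub> r \<otimes>\<^bsub>Fr\<^esub> inv\<^bsub>Fr\<^esub> l" by auto
    then have "r \<in> carrier Fr" "l \<in> carrier Fr" by (auto simp: Rker_iff Lpre_iff)
    then have "?c x = ?c r \<otimes>\<^bsub>Fr\<^esub> ?c l \<otimes>\<^bsub>Fr\<^esub> inv\<^bsub>Fr\<^esub> ?c r \<otimes>\<^bsub>Fr\<^esub> inv\<^bsub>Fr\<^esub> ?c l"
      unfolding rl(3) by (simp only: c.hom_mult c.hom_inv mu.G.m_closed mu.G.inv_closed)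
    then show ?thesis using R[OF rl(1)] L[OF rl(2)] by blast
  next
    assume "x \<in> ?B"
    then obtain r where r: "r \<in> Rker G gs" "x = r [^]\<^bsub>Fr\<^esub> F_k G" by auto
    then have "?c x = ?c r [^]\<^bsub>Fr\<^esub> F_k G"
      by (simp only: Rker_iff c.hom_nat_pow)
    then show ?thesis using R[OF r(1)] by blast
  qed
qed (rule order_trans[OF Kgrp_gens_closed], auto simp: Rker_iff)

sublocale N: normal "Kgrp G gs" Fr
  by (rule Kgrp_normal)

sublocale E: group E
  unfolding Gstar_def by (rule N.factorgroup_is_group)

sublocale nat: group_hom Fr E \<kappa>
  using N.r_coset_hom_Mod by unfold_locales (simp add: Gstar_def)

lemma carrier_E: "carrier E = \<kappa> ` carrier Fr"
  by (simp add: Gstar_def carrier_FactGroup)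

lemma one_E: "\<one>\<^bsub>E\<^esub> = Kgrp G gs"
  by (simp add: Gstar_def)

lemma nat_Kgrp: "w \<in> Kgrp G gs \<Longrightarrow> \<kappa> w = \<one>\<^bsub>E\<^esub>"
  by (simp add: one_E N.rcos_const)

lemma Mset_eq: "M = \<kappa> ` Rker G gs"
  by (auto simp: Mset_def)

text \<open>Representatives of one coset differ by an element of \<open>Kgrp G gs\<close>, which
  \<open>\<mu>\<close> kills. So the arbitrary choice in \<open>proj\<close> is harmless, and \<pi>
  is the map induced by \<mu>.\<close>

lemma proj_nat:
  assumes w: "w \<in> carrier Fr"
  shows "\<pi> (\<kappa> w) = \<mu> w"
proof -
  have "w \<in> \<kappa> w" using w by (rule mu.G.rcos_self) (rule N.subgroup_axioms)
  then have "(SOME v. v \<in> \<kappa> w) \<in> \<kappa> w" by (rule someI)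
  then obtain u where u: "u \<in> Kgrp G gs" "(SOME v. v \<in> \<kappa> w) = u \<otimes>\<^bsub>Fr\<^esub> w"
    by (auto simp: r_coset_def)
  then have "u \<in> carrier Fr" "\<mu> u = \<one>"
    using Kgrp_subset_Rker by (auto simp: Rker_iff)
  then show ?thesis using u w by (simp add: proj_def)
qed

sublocale pr: group_hom E G \<pi>
proof unfold_locales
  show "\<pi> \<in> hom E G"
  proof (rule homI)
    fix x assume "x \<in> carrier E"
    then show "\<pi> x \<in> carrier G" by (auto simp: carrier_E proj_nat)
  next
    fix x y assume "x \<in> carrier E" "y \<in> carrier E"
    then obtain v w where "v \<in> carrier Fr" "w \<in> carrier Fr" "x = \<kappa> v" "y = \<kappa> w"
      by (auto simp: carrier_E)
    then show "\<pi> (x \<otimes>\<^bsub>E\<^esub> y) = \<pi> x \<otimes> \<pi> y"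
      by (simp add: proj_nat flip: nat.hom_mult)
  qed
qed

lemma proj_surj: "\<pi> ` carrier E = carrier G"
proof -
  have "\<pi> ` carrier E = \<mu> ` carrier Fr"
    by (auto simp: carrier_E proj_nat image_image)
  then show ?thesis by (simp add: mu_surj)
qed

lemma M_iff: "x \<in> M \<longleftrightarrow> x \<in> carrier E \<and> \<pi> x = \<one>"
  by (auto simp: Mset_eq carrier_E Rker_iff proj_nat image_iff)

lemma M_eq_kernel: "M = kernel E G \<pi>"
  by (auto simp: M_iff kernel_def)

text \<open>This is what factoring out \<open>[R,L]\<close> achieves. Besides commutativity of
  \<open>M\<close> it gives that \<open>M\<close> centralizes the whole preimage of the Fitting
  subgroup, which is used when automorphisms are lifted.\<close>

lemma M_commute_fitting:
  assumes "x \<in> M" "y \<in> carrier E" "\<pi> y \<in> fitting G"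
  shows "x \<otimes>\<^bsub>E\<^esub> y = y \<otimes>\<^bsub>E\<^esub> x"
proof -
  from assms obtain r l where rl: "r \<in> Rker G gs" "x = \<kappa> r" "l \<in> carrier Fr" "y = \<kappa> l"
    by (auto simp: Mset_eq carrier_E)
  then have "l \<in> Lpre G gs" "r \<in> carrier Fr"
    using assms by (auto simp: Lpre_iff proj_nat Rker_iff)
  then have "r \<otimes>\<^bsub>Fr\<^esub> l \<otimes>\<^bsub>Fr\<^esub> inv\<^bsub>Fr\<^esub> r \<otimes>\<^bsub>Fr\<^esub> inv\<^bsub>Fr\<^esub> l \<in> Kgrp G gs"
    unfolding Kgrp_def using rl by (intro generate.incl) blast
  from nat_Kgrp[OF this] have "x \<otimes>\<^bsub>E\<^esub> y \<otimes>\<^bsub>E\<^esub> inv\<^bsub>E\<^esub> x \<otimes>\<^bsub>E\<^esub> inv\<^bsub>E\<^esub> y = \<one>\<^bsub>E\<^esub>"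
    using rl \<open>r \<in> carrier Fr\<close> by simp
  then show ?thesis
    using assms by (intro E.commutator_eq_one_imp_commute) (auto simp: M_iff)
qed

lemma M_commute: "x \<in> M \<Longrightarrow> y \<in> M \<Longrightarrow> x \<otimes>\<^bsub>E\<^esub> y = y \<otimes>\<^bsub>E\<^esub> x"
  by (rule M_commute_fitting) (auto simp: M_iff one_in_fitting)

lemma M_pow: "x \<in> M \<Longrightarrow> x [^]\<^bsub>E\<^esub> F_k G = \<one>\<^bsub>E\<^esub>"
proof -
  assume "x \<in> M"
  then obtain r where r: "r \<in> Rker G gs" "x = \<kappa> r" by (auto simp: Mset_eq)
  then have "r [^]\<^bsub>Fr\<^esub> F_k G \<in> Kgrp G gs"
    unfolding Kgrp_def by (intro generate.incl) blast
  from nat_Kgrp[OF this] show ?thesis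
    using r by (simp add: Rker_iff nat.hom_nat_pow)
qed

section \<open>Generators and finiteness of the covering group\<close>

definition egens :: "(bool \<times> nat) list set list" where
  "egens = map \<kappa> (free_gens (length gs))"

lemma egens_closed: "set egens \<subseteq> carrier E"
  using free_gens_closed[of "length gs"] by (auto simp: egens_def)

lemma length_egens [simp]: "length egens = length gs"
  by (simp add: egens_def)

text \<open>The quotient map is itself an evaluation map, so \<open>free_lift_image\<close> shows
  that \<open>egens\<close> generates \<open>E\<close>.\<close>

lemma nat_eq_free_lift:
  assumes "w \<in> carrier Fr"
  shows "\<kappa> w = free_lift E egens w"
  using nat.hom_free_lift[OF free_gens_closed, of w] assms
  by (simp add: free_lift_free_gens egens_def carrier_free_group)

lemma generate_egens: "generate E (set egens) = carrier E"
  using E.free_lift_image[OF egens_closed] nat_eq_free_lift by (simp add: carrier_E)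

lemma finite_E: "finite (carrier E)"
proof (rule pr.finite_extension_torsion_kernel[OF _ egens_closed generate_egens finite_carrier proj_surj])
  \<comment> \<open>A product of primes is positive, also when it is empty.\<close>
  show "F_k G > 0"
    by (auto simp: F_k_def intro!: prod_pos dest: in_prime_factors_imp_prime prime_gt_0_nat)
qed (auto simp: M_commute M_pow simp flip: M_eq_kernel)

section \<open>Lifting automorphisms of \<open>G\<close> to the covering group\<close>

lemma lift_automorphism:
  assumes \<theta>: "\<theta> \<in> auto G"
  obtains \<alpha> where "\<alpha> \<in> AutM G gs" "\<And>x. x \<in> carrier E \<Longrightarrow> \<pi> (\<alpha> x) = \<theta> (\<pi> x)"
proof -
  interpret th: group_hom G G \<theta>
    using \<theta> by unfold_locales (auto simp: auto_def)
  have bij: "bij_betw \<theta> (carrier G) (carrier G)" using \<theta> by (auto simp: auto_def Bij_def)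
  have th_surj: "\<theta> ` carrier G = carrier G" using bij by (simp add: bij_betw_def)
  have "generate G (set (map \<theta> gs)) = carrier G"
    using th.generate_img[OF gs_closed] gs_generate th_surj by simp
  \<comment> \<open>Gaschuetz's lemma, applied with \<open>egens\<close> as the known generating
    tuple of the same length.\<close>
  then obtain ys where ys: "set ys \<subseteq> carrier E" "map \<pi> ys = map \<theta> gs" "generate E (set ys) = carrier E"
    using gs_closed
    by (elim pr.generating_tuple_lift[OF finite_E egens_closed generate_egens proj_surj, rotated])
      auto
  have len: "length ys = length gs" using ys(2) by (metis length_map)
  define \<phi> where "\<phi> = free_lift E ys"
  interpret ph: group_hom Fr E \<phi>
    using E.free_lift_hom[OF ys(1)] len unfolding \<phi>_def by unfold_locales simp
  have ph_surj: "\<phi> ` carrier Fr = carrier E"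
    using E.free_lift_image[OF ys(1)] ys(3) len by (simp add: \<phi>_def)
  have proj_ph: "\<pi> (\<phi> w) = \<theta> (\<mu> w)" if "w \<in> carrier Fr" for w
    using that pr.hom_free_lift[OF ys(1), of w] th.hom_free_lift[OF gs_closed, of w] ys(2) len
    by (simp add: \<phi>_def carrier_free_group)
  have ph_R: "\<phi> r \<in> M" if "r \<in> Rker G gs" for r
    using that by (simp add: Rker_iff M_iff proj_ph)
  \<comment> \<open>The images of \<open>R\<close> lie in \<open>M\<close>, and those of
    \<open>L\<close> lie over the Fitting subgroup because \<theta> preserves it. Their commutators
    and the \<open>F_k G\<close>-th powers thus vanish in \<open>E\<close>.\<close>
  have "Kgrp G gs \<subseteq> kernel Fr E \<phi>"
    unfolding Kgrp_def
  proof (rule mu.G.generate_subgroup_incl[OF _ ph.subgroup_kernel], intro Un_least subsetI; clarsimp)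
    fix r l assume r: "r \<in> Rker G gs" and l: "l \<in> Lpre G gs"
    have "\<phi> l \<in> carrier E" "\<pi> (\<phi> l) \<in> fitting G"
      using l proj_ph th.fitting_img[OF th_surj] by (auto simp: Lpre_iff)
    then have "\<phi> r \<otimes>\<^bsub>E\<^esub> \<phi> l = \<phi> l \<otimes>\<^bsub>E\<^esub> \<phi> r" "\<phi> r \<in> carrier E"
      using M_commute_fitting[OF ph_R[OF r]] ph_R[OF r] by (auto simp: M_iff)
    then show "r \<otimes>\<^bsub>Fr\<^esub> l \<otimes>\<^bsub>Fr\<^esub> inv\<^bsub>Fr\<^esub> r \<otimes>\<^bsub>Fr\<^esub> inv\<^bsub>Fr\<^esub> l \<in> kernel Fr E \<phi>"
      using r l by (simp add: kernel_def Rker_iff Lpre_iff E.m_assoc E.inv_cancel_right)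
  next
    fix r assume r: "r \<in> Rker G gs"
    then show "r [^]\<^bsub>Fr\<^esub> F_k G \<in> kernel Fr E \<phi>"
      using M_pow[OF ph_R[OF r]] by (simp add: kernel_def Rker_iff ph.hom_nat_pow)
  qed
  then obtain \<beta> where \<beta>: "\<beta> \<in> hom E E" "\<And>w. w \<in> carrier Fr \<Longrightarrow> \<beta> (\<kappa> w) = \<phi> w"
    using ph.FactGroup_universal_kernel[OF Kgrp_normal] by (metis Gstar_def)
  \<comment> \<open>Members of \<open>auto\<close> are extensional, so the induced endomorphism is
    restricted to the carrier.\<close>
  define \<alpha> where "\<alpha> = restrict \<beta> (carrier E)"
  have proj_al: "\<pi> (\<alpha> x) = \<theta> (\<pi> x)" if "x \<in> carrier E" for x
    using that by (auto simp: carrier_E \<alpha>_def \<beta> proj_ph proj_nat)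
  have al_hom: "\<alpha> \<in> hom E E"
    using \<beta>(1) by (auto simp: \<alpha>_def hom_def)
  have "\<alpha> ` carrier E = carrier E"
    using ph_surj \<beta>(2) by (auto simp: \<alpha>_def carrier_E image_image)
  then have al_bij: "bij_betw \<alpha> (carrier E) (carrier E)"
    using finite_E by (simp add: bij_betw_def finite_surj_inj)
  then have "\<alpha> \<in> auto E"
    using al_hom by (simp add: auto_def Bij_def \<alpha>_def)
  moreover have "\<alpha> ` M = M"
  proof -
    \<comment> \<open>Since \<theta> is injective, \<alpha> reflects membership in \<open>M\<close>
      as well as preserving it; surjectivity on \<open>E\<close> then passes to
      \<open>M\<close>.\<close>
    have iff: "\<alpha> x \<in> M \<longleftrightarrow> x \<in> M" if "x \<in> carrier E" for x
    proof -
      have "\<theta> (\<pi> x) = \<one> \<longleftrightarrow> \<pi> x = \<one>"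
        using that bij th.hom_one by (metis bij_betw_def inj_on_eq_iff one_closed pr.hom_closed)
      then show ?thesis
        using that al_hom by (auto simp: M_iff proj_al hom_def)
    qed
    show ?thesis
    proof
      show "\<alpha> ` M \<subseteq> M" using iff by (auto simp: M_iff)
      show "M \<subseteq> \<alpha> ` M"
      proof
        fix y assume y: "y \<in> M"
        then obtain x where "x \<in> carrier E" "y = \<alpha> x"
          using al_bij by (auto simp: M_iff bij_betw_def)
        then show "y \<in> \<alpha> ` M" using iff y by auto
      qed
    qed
  qed
  ultimately have "\<alpha> \<in> AutM G gs" by (simp add: AutM_def)
  then show thesis using that proj_al by blast
qed

end


section \<open>Automorphisms of the covering group\<close>

context covering
begin

section \<open>Fibres of the projection and the conjugation action on \<open>M\<close>\<close>

lemma projE: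
  assumes "g \<in> carrier G"
  obtains x where "x \<in> carrier E" "g = \<pi> x"
  using assms proj_surj by (metis imageE)

lemma lift_elt: "g \<in> carrier G \<Longrightarrow> lift_elt G gs g \<in> carrier E \<and> \<pi> (lift_elt G gs g) = g"
  unfolding lift_elt_def by (rule someI_ex) (metis projE)

lemma M_carrier: "m \<in> M \<Longrightarrow> m \<in> carrier E"
  by (simp add: M_iff)

lemma M_one: "\<one>\<^bsub>E\<^esub> \<in> M"
  by (simp add: M_iff)

lemma M_mult: "m \<in> M \<Longrightarrow> n \<in> M \<Longrightarrow> m \<otimes>\<^bsub>E\<^esub> n \<in> M"
  by (simp add: M_iff)

lemma M_inv: "m \<in> M \<Longrightarrow> inv\<^bsub>E\<^esub> m \<in> M"
  by (simp add: M_iff)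

lemma M_conj: "x \<in> carrier E \<Longrightarrow> m \<in> M \<Longrightarrow> x \<otimes>\<^bsub>E\<^esub> m \<otimes>\<^bsub>E\<^esub> inv\<^bsub>E\<^esub> x \<in> M"
  by (simp add: M_iff)

lemma M_lcomm:
  "x \<in> M \<Longrightarrow> y \<in> M \<Longrightarrow> z \<in> carrier E \<Longrightarrow> x \<otimes>\<^bsub>E\<^esub> (y \<otimes>\<^bsub>E\<^esub> z) = y \<otimes>\<^bsub>E\<^esub> (x \<otimes>\<^bsub>E\<^esub> z)"
  using M_commute[of x y] by (simp add: M_carrier flip: E.m_assoc)

lemma same_fibre:
  assumes "x \<in> carrier E" "y \<in> carrier E" "\<pi> x = \<pi> y"
  obtains m where "m \<in> M" "x = m \<otimes>\<^bsub>E\<^esub> y"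
proof
  show "x \<otimes>\<^bsub>E\<^esub> inv\<^bsub>E\<^esub> y \<in> M" "x = x \<otimes>\<^bsub>E\<^esub> inv\<^bsub>E\<^esub> y \<otimes>\<^bsub>E\<^esub> y"
    using assms by (auto simp: M_iff E.m_assoc)
qed

text \<open>Two preimages of the same element differ by a factor from \<open>M\<close>, and
  conjugation by such a factor is trivial on \<open>M\<close>. The chosen preimage in
  \<open>gam\<close> may thus be replaced by any other.\<close>

lemma gam_proj:
  assumes x: "x \<in> carrier E" and m: "m \<in> M"
  shows "gam G gs (\<pi> x) m = x \<otimes>\<^bsub>E\<^esub> m \<otimes>\<^bsub>E\<^esub> inv\<^bsub>E\<^esub> x"
proof -
  let ?y = "lift_elt G gs (\<pi> x)"
  have "?y \<in> carrier E" "\<pi> ?y = \<pi> x" using x lift_elt by auto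
  then obtain n where n: "n \<in> M" "?y = n \<otimes>\<^bsub>E\<^esub> x" using x by (metis same_fibre)
  let ?c = "x \<otimes>\<^bsub>E\<^esub> m \<otimes>\<^bsub>E\<^esub> inv\<^bsub>E\<^esub> x"
  have "?y \<otimes>\<^bsub>E\<^esub> m \<otimes>\<^bsub>E\<^esub> inv\<^bsub>E\<^esub> ?y = n \<otimes>\<^bsub>E\<^esub> ?c \<otimes>\<^bsub>E\<^esub> inv\<^bsub>E\<^esub> n"
    using n x m by (simp add: E.m_assoc E.inv_mult_group M_carrier)
  also have "\<dots> = ?c"
    using M_commute[OF n(1) M_conj[OF x m]] n x m by (simp add: E.m_assoc M_carrier)
  finally show ?thesis using m by (simp add: gam_def)
qed

lemma gam_closed: "g \<in> carrier G \<Longrightarrow> m \<in> M \<Longrightarrow> gam G gs g m \<in> M"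
  by (erule projE) (simp add: gam_proj M_conj)

lemma gam_mult:
  "g \<in> carrier G \<Longrightarrow> m \<in> M \<Longrightarrow> n \<in> M \<Longrightarrow>
    gam G gs g (m \<otimes>\<^bsub>E\<^esub> n) = gam G gs g m \<otimes>\<^bsub>E\<^esub> gam G gs g n"
  by (erule projE) (simp add: gam_proj M_mult M_carrier E.m_assoc E.inv_cancel_left)

lemma gam_one: "m \<in> M \<Longrightarrow> gam G gs \<one> m = m"
  using gam_proj[of "\<one>\<^bsub>E\<^esub>" m] by (simp add: M_carrier)

lemma gam_E_one: "g \<in> carrier G \<Longrightarrow> gam G gs g \<one>\<^bsub>E\<^esub> = \<one>\<^bsub>E\<^esub>"
  by (erule projE) (simp add: gam_proj M_one)

section \<open>The group of automorphisms leaving \<open>M\<close> invariant\<close>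

lemma AutMD:
  assumes "\<alpha> \<in> AutM G gs"
  shows "\<alpha> \<in> hom E E" "bij_betw \<alpha> (carrier E) (carrier E)" "\<alpha> \<in> extensional (carrier E)"
    "\<alpha> ` M = M" "\<alpha> \<in> Bij (carrier E)"
  using assms by (auto simp: AutM_def auto_def Bij_def)

lemma AutM_group_hom: "\<alpha> \<in> AutM G gs \<Longrightarrow> group_hom E E \<alpha>"
  by unfold_locales (rule AutMD)

lemma AutM_M: "\<alpha> \<in> AutM G gs \<Longrightarrow> m \<in> M \<Longrightarrow> \<alpha> m \<in> M"
  using AutMD(4) by blast

lemma AutM_closed: "\<alpha> \<in> AutM G gs \<Longrightarrow> x \<in> carrier E \<Longrightarrow> \<alpha> x \<in> carrier E"
  by (rule group_hom.hom_closed[OF AutM_group_hom])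

lemma AutM_mult:
  "\<alpha> \<in> AutM G gs \<Longrightarrow> x \<in> carrier E \<Longrightarrow> y \<in> carrier E \<Longrightarrow> \<alpha> (x \<otimes>\<^bsub>E\<^esub> y) = \<alpha> x \<otimes>\<^bsub>E\<^esub> \<alpha> y"
  using AutMD(1) by (simp add: hom_mult)

lemma AutM_inv: "\<alpha> \<in> AutM G gs \<Longrightarrow> x \<in> carrier E \<Longrightarrow> \<alpha> (inv\<^bsub>E\<^esub> x) = inv\<^bsub>E\<^esub> \<alpha> x"
  by (rule group_hom.hom_inv[OF AutM_group_hom])

lemma AutM_M_iff:
  assumes "\<alpha> \<in> AutM G gs" "x \<in> carrier E"
  shows "\<alpha> x \<in> M \<longleftrightarrow> x \<in> M"
proof
  assume "\<alpha> x \<in> M"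
  then obtain m where "m \<in> M" "\<alpha> x = \<alpha> m" using AutMD(4)[OF assms(1)] by auto
  moreover have "inj_on \<alpha> (carrier E)" using AutMD(2)[OF assms(1)] by (simp add: bij_betw_def)
  ultimately show "x \<in> M" using assms(2) M_carrier by (metis inj_on_eq_iff)
qed (use assms AutM_M in blast)

text \<open>The second carrier update overrides the one inside \<open>AutoGroup\<close>, so subgroup
  arguments can be carried out in \<open>BijGroup\<close>.\<close>

lemma AutM_group_eq: "AutM_group G gs = (BijGroup (carrier E))\<lparr>carrier := AutM G gs\<rparr>"
  by (simp add: AutM_group_def AutoGroup_def)

lemma subgroup_AutM: "subgroup (AutM G gs) (BijGroup (carrier E))"
proof -
  interpret A: subgroup "auto E" "BijGroup (carrier E)" by (rule E.subgroup_auto)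
  show ?thesis
  proof (rule subgroup.intro)
    show "AutM G gs \<subseteq> carrier (BijGroup (carrier E))"
      using A.subset by (auto simp: AutM_def)
    show "\<one>\<^bsub>BijGroup (carrier E)\<^esub> \<in> AutM G gs"
      using A.one_closed M_carrier by (auto simp: AutM_def BijGroup_def)
  next
    fix \<alpha> \<beta> assume a: "\<alpha> \<in> AutM G gs" and b: "\<beta> \<in> AutM G gs"
    have "compose (carrier E) \<alpha> \<beta> ` M = \<alpha> ` (\<beta> ` M)"
      using M_carrier by (auto simp: compose_def image_image)
    then have "compose (carrier E) \<alpha> \<beta> ` M = M"
      using AutMD(4)[OF a] AutMD(4)[OF b] by simp
    then show "\<alpha> \<otimes>\<^bsub>BijGroup (carrier E)\<^esub> \<beta> \<in> AutM G gs"
      using A.m_closed[of \<alpha> \<beta>] a b AutMD(5) by (auto simp: AutM_def BijGroup_def)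
  next
    fix \<alpha> assume a: "\<alpha> \<in> AutM G gs"
    have inj: "inj_on \<alpha> (carrier E)" using AutMD(2)[OF a] by (simp add: bij_betw_def)
    have "restrict (inv_into (carrier E) \<alpha>) (carrier E) ` M = inv_into (carrier E) \<alpha> ` M"
      using M_carrier by (auto simp: image_iff)
    also have "\<dots> = inv_into (carrier E) \<alpha> ` (\<alpha> ` M)" using AutMD(4)[OF a] by simp
    also have "\<dots> = M" using inj M_carrier by (simp add: inv_into_image_cancel subset_iff)
    finally show "inv\<^bsub>BijGroup (carrier E)\<^esub> \<alpha> \<in> AutM G gs"
      using A.m_inv_closed[of \<alpha>] a AutMD(5)[OF a] by (simp add: AutM_def inv_BijGroup)
  qed
qed

lemma group_AutM: "group (AutM_group G gs)"
  unfolding AutM_group_eq by (rule subgroup.subgroup_is_group[OF subgroup_AutM group_BijGroup])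

lemma BijGroup_mult_AutM:
  "\<alpha> \<in> AutM G gs \<Longrightarrow> \<beta> \<in> AutM G gs \<Longrightarrow>
    \<alpha> \<otimes>\<^bsub>BijGroup (carrier E)\<^esub> \<beta> = compose (carrier E) \<alpha> \<beta>"
  by (simp add: BijGroup_def AutMD(5))

section \<open>The induced automorphisms of \<open>G\<close> and the kernel \<open>W\<close>\<close>

text \<open>Changing the preimage multiplies it by an element of \<open>M\<close>; \<alpha> keeps
  that element in \<open>M\<close>, where \<pi> is trivial. The choice of lift in
  \<open>eta_G\<close> is therefore immaterial.\<close>

lemma eta_G_proj:
  assumes a: "\<alpha> \<in> AutM G gs" and x: "x \<in> carrier E"
  shows "eta_G G gs \<alpha> (\<pi> x) = \<pi> (\<alpha> x)"
proof -
  let ?y = "lift_elt G gs (\<pi> x)"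
  have y: "?y \<in> carrier E" "\<pi> ?y = \<pi> x" using x lift_elt by auto
  then obtain n where n: "n \<in> M" "?y = n \<otimes>\<^bsub>E\<^esub> x" using x by (metis same_fibre)
  have "\<pi> (\<alpha> ?y) = \<pi> (\<alpha> x)"
    using n x a AutM_M[OF a n(1)] by (simp add: AutM_mult M_iff AutM_closed)
  then show ?thesis using x by (simp add: eta_G_def)
qed

lemma eta_G_auto:
  assumes a: "\<alpha> \<in> AutM G gs"
  shows "eta_G G gs \<alpha> \<in> auto G"
proof -
  have hom: "eta_G G gs \<alpha> \<in> hom G G"
  proof (rule homI)
    fix g assume "g \<in> carrier G"
    then show "eta_G G gs \<alpha> g \<in> carrier G"
      by (rule projE) (simp add: a eta_G_proj AutM_closed)
  next
    fix g h assume "g \<in> carrier G" "h \<in> carrier G"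
    then obtain x y where "x \<in> carrier E" "y \<in> carrier E" "g = \<pi> x" "h = \<pi> y" by (metis projE)
    then show "eta_G G gs \<alpha> (g \<otimes> h) = eta_G G gs \<alpha> g \<otimes> eta_G G gs \<alpha> h"
      using a by (simp add: eta_G_proj AutM_mult AutM_closed flip: pr.hom_mult)
  qed
  interpret e: group_hom G G "eta_G G gs \<alpha>" by unfold_locales (rule hom)
  \<comment> \<open>A trivial image places \<open>\<alpha> x\<close> in \<open>M\<close>, and then
    \<open>x\<close> lies in \<open>M\<close> already, since \<alpha> is injective and maps
    \<open>M\<close> onto itself.\<close>
  have "inj_on (eta_G G gs \<alpha>) (carrier G)"
  proof (rule e.inj_on_one_iff[THEN iffD2], intro allI impI)
    fix g assume g: "g \<in> carrier G" "eta_G G gs \<alpha> g = \<one>"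
    then obtain x where x: "x \<in> carrier E" "g = \<pi> x" by (metis projE)
    then have "\<alpha> x \<in> M" using g a by (simp add: eta_G_proj M_iff AutM_closed)
    then show "g = \<one>" using x a by (simp add: AutM_M_iff) (simp add: M_iff)
  qed
  moreover have "eta_G G gs \<alpha> ` carrier G = carrier G"
  proof
    show "carrier G \<subseteq> eta_G G gs \<alpha> ` carrier G"
    proof
      fix g assume "g \<in> carrier G"
      then obtain x where x: "x \<in> carrier E" "g = \<pi> x" by (rule projE)
      then obtain y where "y \<in> carrier E" "x = \<alpha> y"
        using AutMD(2)[OF a] by (auto simp: bij_betw_def)
      then show "g \<in> eta_G G gs \<alpha> ` carrier G"
        using x a by (auto simp: eta_G_proj intro!: image_eqI[of _ _ "\<pi> y"])
    qed
  qed auto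
  ultimately show ?thesis
    using hom by (simp add: auto_def Bij_def bij_betw_def eta_G_def)
qed

lemma eta_G_image: "eta_G G gs ` AutM G gs = auto G"
proof
  show "auto G \<subseteq> eta_G G gs ` AutM G gs"
  proof
    fix \<theta> assume \<theta>: "\<theta> \<in> auto G"
    then obtain \<alpha> where \<alpha>: "\<alpha> \<in> AutM G gs" "\<And>x. x \<in> carrier E \<Longrightarrow> \<pi> (\<alpha> x) = \<theta> (\<pi> x)"
      by (rule lift_automorphism) blast
    have "eta_G G gs \<alpha> = \<theta>"
    proof (rule extensionalityI[of _ "carrier G"])
      fix g assume "g \<in> carrier G"
      then show "eta_G G gs \<alpha> g = \<theta> g" by (rule projE) (simp add: \<alpha> eta_G_proj)
    qed (use \<theta> in \<open>auto simp: eta_G_def auto_def Bij_def\<close>)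
    then show "\<theta> \<in> eta_G G gs ` AutM G gs" using \<alpha>(1) by blast
  qed
qed (auto simp: eta_G_auto)

lemma eta_G_group_hom: "group_hom (AutM_group G gs) (AutoGroup G) (eta_G G gs)"
proof -
  have "eta_G G gs \<in> hom (AutM_group G gs) (AutoGroup G)"
  proof (rule homI)
    fix \<alpha> \<beta> assume "\<alpha> \<in> carrier (AutM_group G gs)" "\<beta> \<in> carrier (AutM_group G gs)"
    then have a: "\<alpha> \<in> AutM G gs" and b: "\<beta> \<in> AutM G gs" by (auto simp: AutM_group_eq)
    have ab: "compose (carrier E) \<alpha> \<beta> \<in> AutM G gs"
      using subgroup.m_closed[OF subgroup_AutM a b] a b by (simp add: BijGroup_mult_AutM)
    have "eta_G G gs (compose (carrier E) \<alpha> \<beta>) =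
        compose (carrier G) (eta_G G gs \<alpha>) (eta_G G gs \<beta>)"
    proof (rule extensionalityI[of _ "carrier G"])
      fix g assume "g \<in> carrier G"
      then obtain x where x: "x \<in> carrier E" "g = \<pi> x" by (rule projE)
      then show "eta_G G gs (compose (carrier E) \<alpha> \<beta>) g =
          compose (carrier G) (eta_G G gs \<alpha>) (eta_G G gs \<beta>) g"
        using a b ab by (simp add: eta_G_proj compose_def AutM_closed)
    qed (auto simp: eta_G_def)
    moreover have "eta_G G gs \<alpha> \<in> Bij (carrier G)" "eta_G G gs \<beta> \<in> Bij (carrier G)"
      using eta_G_auto a b by (auto simp: auto_def)
    ultimately show "eta_G G gs (\<alpha> \<otimes>\<^bsub>AutM_group G gs\<^esub> \<beta>) = eta_G G gs \<alpha> \<otimes>\<^bsub>AutoGroup G\<^esub> eta_G G gs \<beta>"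
      using a b by (simp add: AutM_group_eq BijGroup_mult_AutM AutoGroup_def) (simp add: BijGroup_def)
  qed (auto simp: AutM_group_eq AutoGroup_def eta_G_auto)
  then show ?thesis
    using group_AutM AutoGroup by (simp add: group_hom_def group_hom_axioms_def)
qed

lemma kernel_eta_G: "kernel (AutM_group G gs) (AutoGroup G) (eta_G G gs) = Wset G gs"
  unfolding kernel_def Wset_def AutM_group_eq AutoGroup_def by (simp add: BijGroup_def)

lemma AutM_Mod_Wset: "AutM_group G gs Mod Wset G gs \<cong> AutoGroup G"
proof -
  have "eta_G G gs ` carrier (AutM_group G gs) = carrier (AutoGroup G)"
    using eta_G_image by (simp add: AutM_group_eq AutoGroup_def)
  from group_hom.FactGroup_iso[OF eta_G_group_hom this] show ?thesis
    by (simp add: kernel_eta_G)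
qed

text \<open>Describes \<open>W\<close> by compatibility with \<pi>, so that the chosen lifts inside
  \<open>eta_G\<close> disappear from later arguments.\<close>

lemma Wset_iff: "\<alpha> \<in> Wset G gs \<longleftrightarrow> \<alpha> \<in> AutM G gs \<and> (\<forall>x\<in>carrier E. \<pi> (\<alpha> x) = \<pi> x)"
proof -
  have "eta_G G gs \<alpha> = (\<lambda>g\<in>carrier G. g) \<longleftrightarrow> (\<forall>x\<in>carrier E. \<pi> (\<alpha> x) = \<pi> x)"
    if a: "\<alpha> \<in> AutM G gs"
  proof
    assume "eta_G G gs \<alpha> = (\<lambda>g\<in>carrier G. g)"
    then show "\<forall>x\<in>carrier E. \<pi> (\<alpha> x) = \<pi> x" using eta_G_proj[OF a] by (metis pr.hom_closed restrict_apply')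
  next
    assume eq: "\<forall>x\<in>carrier E. \<pi> (\<alpha> x) = \<pi> x"
    show "eta_G G gs \<alpha> = (\<lambda>g\<in>carrier G. g)"
    proof (rule extensionalityI[of _ "carrier G"])
      fix g assume "g \<in> carrier G"
      then show "eta_G G gs \<alpha> g = (\<lambda>g\<in>carrier G. g) g"
        by (rule projE) (simp add: eta_G_proj a eq)
    qed (auto simp: eta_G_def)
  qed
  then show ?thesis by (auto simp: Wset_def)
qed

lemma Vset_iff: "\<alpha> \<in> Vset G gs \<longleftrightarrow> \<alpha> \<in> Wset G gs \<and> (\<forall>m\<in>M. \<alpha> m = m)"
proof -
  have "eta_M G gs \<alpha> = (\<lambda>x\<in>M. x) \<longleftrightarrow> (\<forall>m\<in>M. \<alpha> m = m)"
  proof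
    assume "eta_M G gs \<alpha> = (\<lambda>x\<in>M. x)"
    from fun_cong[OF this] have "\<alpha> m = m" if "m \<in> M" for m
      using that by (metis eta_M_def restrict_apply')
    then show "\<forall>m\<in>M. \<alpha> m = m" by blast
  next
    assume "\<forall>m\<in>M. \<alpha> m = m"
    then show "eta_M G gs \<alpha> = (\<lambda>x\<in>M. x)" unfolding eta_M_def by (intro restrict_ext) blast
  qed
  then show ?thesis by (auto simp: Vset_def)
qed


section \<open>Restriction to \<open>M\<close> and the quotient of \<open>W\<close> by
  \<open>V\<close>\<close>

lemma subgroup_M: "subgroup M E"
  unfolding M_eq_kernel by (rule pr.subgroup_kernel)

lemma group_Mgroup: "group (Mgroup G gs)"
  unfolding Mgroup_def using subgroup_M by (rule E.subgroup_imp_group)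

lemma eta_M_auto:
  assumes a: "\<alpha> \<in> AutM G gs"
  shows "eta_M G gs \<alpha> \<in> auto (Mgroup G gs)"
proof -
  have "inj_on \<alpha> M"
    by (rule inj_on_subset[of _ "carrier E"])
      (use AutMD(2)[OF a] M_carrier in \<open>auto simp: bij_betw_def\<close>)
  then have "bij_betw (restrict \<alpha> M) M M"
    using AutMD(4)[OF a] by (simp add: bij_betw_def)
  moreover have "restrict \<alpha> M \<in> hom (Mgroup G gs) (Mgroup G gs)"
    by (rule homI) (auto simp: Mgroup_def a AutM_M M_mult AutM_mult M_carrier)
  ultimately show ?thesis
    by (simp add: auto_def Bij_def eta_M_def) (simp add: Mgroup_def)
qed

lemma Wset_subset_AutM: "\<alpha> \<in> Wset G gs \<Longrightarrow> \<alpha> \<in> AutM G gs"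
  by (simp add: Wset_def)

lemma subgroup_Wset: "subgroup (Wset G gs) (AutM_group G gs)"
  unfolding kernel_eta_G[symmetric] by (rule group_hom.subgroup_kernel[OF eta_G_group_hom])

text \<open>The first isomorphism theorem for \<open>eta_M\<close> on \<open>W\<close>: the codomain
  is cut down to the image to make the map onto, and its kernel is \<open>V\<close> by
  definition.\<close>

lemma Wset_Mod_Vset:
  "(AutM_group G gs)\<lparr>carrier := Wset G gs\<rparr> Mod Vset G gs
    \<cong> (AutoGroup (Mgroup G gs))\<lparr>carrier := eta_M G gs ` Wset G gs\<rparr>"
proof -
  let ?W = "(AutM_group G gs)\<lparr>carrier := Wset G gs\<rparr>"
  let ?A = "AutoGroup (Mgroup G gs)"
  let ?I = "?A\<lparr>carrier := eta_M G gs ` Wset G gs\<rparr>"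
  have W: "group ?W"
    by (rule group.subgroup_imp_group[OF group_AutM subgroup_Wset])
  have A: "group ?A" by (rule group.AutoGroup[OF group_Mgroup])
  have hom: "eta_M G gs \<in> hom ?W ?A"
  proof (rule homI)
    fix \<alpha> \<beta> assume "\<alpha> \<in> carrier ?W" "\<beta> \<in> carrier ?W"
    then have a: "\<alpha> \<in> AutM G gs" and b: "\<beta> \<in> AutM G gs" by (auto simp: Wset_subset_AutM)
    have "eta_M G gs (compose (carrier E) \<alpha> \<beta>) = compose M (eta_M G gs \<alpha>) (eta_M G gs \<beta>)"
      by (rule extensionalityI[of _ M]) (auto simp: eta_M_def compose_def M_carrier AutM_M[OF b])
    moreover have "eta_M G gs \<alpha> \<in> Bij M" "eta_M G gs \<beta> \<in> Bij M"
      using eta_M_auto[OF a] eta_M_auto[OF b] by (auto simp: auto_def Mgroup_def)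
    ultimately show "eta_M G gs (\<alpha> \<otimes>\<^bsub>?W\<^esub> \<beta>) = eta_M G gs \<alpha> \<otimes>\<^bsub>?A\<^esub> eta_M G gs \<beta>"
      using a b by (simp add: AutM_group_eq BijGroup_mult_AutM AutoGroup_def Mgroup_def)
        (simp add: BijGroup_def)
  qed (auto simp: AutoGroup_def intro: eta_M_auto Wset_subset_AutM)
  interpret h: group_hom ?W ?A "eta_M G gs"
    using W A hom by (simp add: group_hom_def group_hom_axioms_def)
  have I: "group ?I"
    using group.subgroup_imp_group[OF A h.img_is_subgroup] by simp
  have "eta_M G gs \<in> hom ?W ?I"
    using hom by (auto simp: hom_def)
  then interpret i: group_hom ?W ?I "eta_M G gs"
    using W I by (simp add: group_hom_def group_hom_axioms_def)
  have "kernel ?W ?I (eta_M G gs) = Vset G gs"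
    unfolding kernel_def Vset_def AutoGroup_def by (simp add: BijGroup_def Mgroup_def)
  then show ?thesis using i.FactGroup_iso by simp
qed

text \<open>Finiteness of \<open>E\<close> turns injectivity into bijectivity. Compatibility with
  \<pi> sends \<open>M\<close> into itself, and injectivity on the finite set \<open>M\<close> makes
  this onto.\<close>

lemma WsetI:
  assumes hom: "\<alpha> \<in> hom E E" and ext: "\<alpha> \<in> extensional (carrier E)"
    and inj: "inj_on \<alpha> (carrier E)" and proj: "\<And>x. x \<in> carrier E \<Longrightarrow> \<pi> (\<alpha> x) = \<pi> x"
  shows "\<alpha> \<in> Wset G gs"
proof -
  have closed: "\<alpha> x \<in> carrier E" if "x \<in> carrier E" for x
    using hom that by (rule hom_in_carrier)
  have "\<alpha> ` carrier E = carrier E"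
    by (rule endo_inj_surj[OF finite_E _ inj]) (auto simp: closed)
  moreover have "\<alpha> ` M = M"
  proof (rule endo_inj_surj)
    show "finite M" by (rule finite_subset[OF _ finite_E]) (auto simp: M_iff)
    show "\<alpha> ` M \<subseteq> M" by (auto simp: M_iff closed proj)
    show "inj_on \<alpha> M" by (rule inj_on_subset[OF inj]) (auto simp: M_iff)
  qed
  ultimately show ?thesis
    using assms by (simp add: Wset_iff AutM_def auto_def Bij_def bij_betw_def)
qed

section \<open>Coboundaries and cohomology classes\<close>

text \<open>In additive notation, the coboundary g t(h) - t(gh) + t(g) of the 1-cochain
  \<open>t\<close>.\<close>

definition cobd :: "('a \<Rightarrow> (bool \<times> nat) list set) \<Rightarrow> 'a \<times> 'a \<Rightarrow> (bool \<times> nat) list set" where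
  "cobd t = (\<lambda>(g, h) \<in> carrier G \<times> carrier G.
     gam G gs g (t h) \<otimes>\<^bsub>E\<^esub> inv\<^bsub>E\<^esub> (t (g \<otimes> h)) \<otimes>\<^bsub>E\<^esub> t g)"

lemma B2_eq: "B2 G gs = cobd ` (carrier G \<rightarrow>\<^sub>E M)"
  by (auto simp: B2_def cobd_def)

lemma cobd_closed:
  "t \<in> carrier G \<rightarrow>\<^sub>E M \<Longrightarrow> p \<in> carrier G \<times> carrier G \<Longrightarrow> cobd t p \<in> M"
  by (auto simp: cobd_def intro!: M_mult M_inv gam_closed)

lemma cobd_mult:
  assumes t: "t \<in> carrier G \<rightarrow>\<^sub>E M" and u: "u \<in> carrier G \<rightarrow>\<^sub>E M"
    and p: "p \<in> carrier G \<times> carrier G"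
  shows "cobd (\<lambda>g\<in>carrier G. t g \<otimes>\<^bsub>E\<^esub> u g) p = cobd t p \<otimes>\<^bsub>E\<^esub> cobd u p"
proof -
  obtain g h where gh: "p = (g, h)" "g \<in> carrier G" "h \<in> carrier G" using p by auto
  have M: "t x \<in> M" "u x \<in> M" if "x \<in> carrier G" for x using t u that by auto
  have "inv\<^bsub>E\<^esub> (t (g \<otimes> h) \<otimes>\<^bsub>E\<^esub> u (g \<otimes> h)) = inv\<^bsub>E\<^esub> t (g \<otimes> h) \<otimes>\<^bsub>E\<^esub> inv\<^bsub>E\<^esub> u (g \<otimes> h)"
    using gh M M_commute by (simp add: E.inv_mult_group M_carrier M_inv)
  then show ?thesis
    using gh M by (simp add: cobd_def gam_mult E.m_assoc M_carrier gam_closed M_inv M_mult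
        M_commute M_lcomm)
qed

text \<open>Shifting by the coboundaries of \<open>t\<close> and \<open>u\<close> in turn is
  shifting by that of their product, and multiplication by \<open>t\<close> is a bijection of the
  1-cochains. So both classes consist of the same functions.\<close>

lemma H2class_shift:
  assumes \<delta>: "\<And>p. p \<in> carrier G \<times> carrier G \<Longrightarrow> \<delta> p \<in> M"
    and t: "t \<in> carrier G \<rightarrow>\<^sub>E M"
  shows "H2class G gs (\<lambda>p\<in>carrier G \<times> carrier G. \<delta> p \<otimes>\<^bsub>E\<^esub> cobd t p) = H2class G gs \<delta>"
proof -
  let ?P = "carrier G \<times> carrier G"
  let ?sh = "\<lambda>\<delta> u. \<lambda>p\<in>?P. \<delta> p \<otimes>\<^bsub>E\<^esub> cobd u p"
  have cls: "H2class G gs \<delta>' = ?sh \<delta>' ` (carrier G \<rightarrow>\<^sub>E M)" for \<delta>'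
    by (auto simp: H2class_def B2_eq)
  have 1: "?sh (?sh \<delta> t) u = ?sh \<delta> (\<lambda>g\<in>carrier G. t g \<otimes>\<^bsub>E\<^esub> u g)" if u: "u \<in> carrier G \<rightarrow>\<^sub>E M" for u
    by (rule restrict_ext)
      (use t u \<delta> cobd_closed in \<open>simp add: cobd_mult E.m_assoc M_carrier\<close>)
  have mem: "(\<lambda>g\<in>carrier G. t g \<otimes>\<^bsub>E\<^esub> u g) \<in> carrier G \<rightarrow>\<^sub>E M"
    "(\<lambda>g\<in>carrier G. inv\<^bsub>E\<^esub> t g \<otimes>\<^bsub>E\<^esub> u g) \<in> carrier G \<rightarrow>\<^sub>E M" if "u \<in> carrier G \<rightarrow>\<^sub>E M" for u
    using t that by (auto intro!: M_mult M_inv)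
  have 2: "(\<lambda>g\<in>carrier G. t g \<otimes>\<^bsub>E\<^esub> (\<lambda>g\<in>carrier G. inv\<^bsub>E\<^esub> t g \<otimes>\<^bsub>E\<^esub> u g) g) = u"
    if u: "u \<in> carrier G \<rightarrow>\<^sub>E M" for u
  proof (rule extensionalityI[of _ "carrier G"])
    fix g assume g: "g \<in> carrier G"
    then have "t g \<in> M" "u g \<in> M" using t u by auto
    then show "(\<lambda>g\<in>carrier G. t g \<otimes>\<^bsub>E\<^esub> (\<lambda>g\<in>carrier G. inv\<^bsub>E\<^esub> t g \<otimes>\<^bsub>E\<^esub> u g) g) g = u g"
      using g by (simp add: E.inv_cancel_right M_carrier)
  qed (use u in \<open>auto simp: PiE_def\<close>)
  show ?thesis
    unfolding cls
  proof
    show "?sh (?sh \<delta> t) ` (carrier G \<rightarrow>\<^sub>E M) \<subseteq> ?sh \<delta> ` (carrier G \<rightarrow>\<^sub>E M)"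
      using 1 mem(1) by blast
    show "?sh \<delta> ` (carrier G \<rightarrow>\<^sub>E M) \<subseteq> ?sh (?sh \<delta> t) ` (carrier G \<rightarrow>\<^sub>E M)"
    proof
      fix f assume "f \<in> ?sh \<delta> ` (carrier G \<rightarrow>\<^sub>E M)"
      then obtain u where u: "u \<in> carrier G \<rightarrow>\<^sub>E M" "f = ?sh \<delta> u" by blast
      have "f = ?sh (?sh \<delta> t) (\<lambda>g\<in>carrier G. inv\<^bsub>E\<^esub> t g \<otimes>\<^bsub>E\<^esub> u g)"
        unfolding u(2) 1[OF mem(2)[OF u(1)]] 2[OF u(1)] ..
      then show "f \<in> ?sh (?sh \<delta> t) ` (carrier G \<rightarrow>\<^sub>E M)" using mem(2)[OF u(1)] by blast
    qed
  qed
qed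

text \<open>The trivial 1-cochain has trivial coboundary. This converts an equality of classes into
  an explicit cochain relating two representatives.\<close>

lemma H2class_self:
  assumes \<delta>: "\<delta> \<in> extensional (carrier G \<times> carrier G)" "\<And>p. p \<in> carrier G \<times> carrier G \<Longrightarrow> \<delta> p \<in> M"
  shows "\<delta> \<in> H2class G gs \<delta>"
proof -
  let ?e = "\<lambda>g\<in>carrier G. \<one>\<^bsub>E\<^esub>"
  have "\<delta> = (\<lambda>p\<in>carrier G \<times> carrier G. \<delta> p \<otimes>\<^bsub>E\<^esub> cobd ?e p)"
    by (rule extensionalityI[of _ "carrier G \<times> carrier G"])
      (use \<delta> in \<open>auto simp: cobd_def gam_E_one M_carrier\<close>)
  moreover have "?e \<in> carrier G \<rightarrow>\<^sub>E M" using M_one by auto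
  ultimately show ?thesis unfolding H2class_def B2_eq by blast
qed

section \<open>The image of \<open>W\<close> in the automorphisms of \<open>M\<close> as a
  stabilizer\<close>

context
  fixes s
  assumes s: "\<And>g. g \<in> carrier G \<Longrightarrow> s g \<in> carrier E" "\<And>g. g \<in> carrier G \<Longrightarrow> \<pi> (s g) = g"
begin

lemma eps_closed: "p \<in> carrier G \<times> carrier G \<Longrightarrow> eps_of G gs s p \<in> M"
  by (auto simp: eps_of_def M_iff s)

lemma gam_section: "g \<in> carrier G \<Longrightarrow> m \<in> M \<Longrightarrow> gam G gs g m = s g \<otimes>\<^bsub>E\<^esub> m \<otimes>\<^bsub>E\<^esub> inv\<^bsub>E\<^esub> s g"
  using gam_proj[of "s g" m] s by simp

lemma section_mult:
  assumes "g \<in> carrier G" "h \<in> carrier G"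
  shows "s g \<otimes>\<^bsub>E\<^esub> s h = eps_of G gs s (g, h) \<otimes>\<^bsub>E\<^esub> s (g \<otimes> h)"
  using assms s by (simp add: eps_of_def E.m_assoc)

lemma section_conj:
  assumes "g \<in> carrier G" "m \<in> M"
  shows "s g \<otimes>\<^bsub>E\<^esub> m = gam G gs g m \<otimes>\<^bsub>E\<^esub> s g"
  using assms s by (simp add: gam_section E.m_assoc M_carrier)

text \<open>The failure of \<alpha> to fix the section is a 1-cochain \<open>t\<close> with values
  in \<open>M\<close>. Applying \<alpha> to the product rule of the section shows that
  \<open>c\<close> changes the cocycle by exactly the coboundary of \<open>t\<close>.\<close>

lemma eta_M_Wset_subset: "eta_M G gs ` Wset G gs \<subseteq> Stab_C G gs (eps_of G gs s)"
proof
  let ?P = "carrier G \<times> carrier G"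
  fix c assume "c \<in> eta_M G gs ` Wset G gs"
  then obtain \<alpha> where \<alpha>: "\<alpha> \<in> Wset G gs" and c: "c = eta_M G gs \<alpha>" by blast
  have a: "\<alpha> \<in> AutM G gs" using \<alpha> by (rule Wset_subset_AutM)
  have pa: "\<pi> (\<alpha> x) = \<pi> x" if "x \<in> carrier E" for x using \<alpha> that by (simp add: Wset_iff)
  have cm: "c m = \<alpha> m" if "m \<in> M" for m using that by (simp add: c eta_M_def)
  \<comment> \<open>Conjugation by \<open>\<alpha> x\<close> and by \<open>x\<close> agree on
    \<open>M\<close>, because both elements lie over the same element of \<open>G\<close>.\<close>
  have "compose M c (gam G gs g) = compose M (gam G gs g) c" if g: "g \<in> carrier G" for g
  proof (rule extensionalityI[of _ M])
    fix m assume m: "m \<in> M"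
    obtain x where x: "x \<in> carrier E" "g = \<pi> x" using g by (rule projE)
    have "\<alpha> (x \<otimes>\<^bsub>E\<^esub> m \<otimes>\<^bsub>E\<^esub> inv\<^bsub>E\<^esub> x) = \<alpha> x \<otimes>\<^bsub>E\<^esub> \<alpha> m \<otimes>\<^bsub>E\<^esub> inv\<^bsub>E\<^esub> \<alpha> x"
      using x m a by (simp add: AutM_mult AutM_inv M_carrier)
    also have "\<dots> = gam G gs (\<pi> x) (\<alpha> m)"
      using gam_proj[of "\<alpha> x" "\<alpha> m"] x m a by (simp add: AutM_closed AutM_M pa)
    finally show "compose M c (gam G gs g) m = compose M (gam G gs g) c m"
      using x m a by (simp add: compose_def gam_proj M_conj cm)
  qed auto
  then have cC: "c \<in> Cset G gs"
    using eta_M_auto[OF a] by (simp add: Cset_def c)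
  define t where "t = (\<lambda>g\<in>carrier G. \<alpha> (s g) \<otimes>\<^bsub>E\<^esub> inv\<^bsub>E\<^esub> s g)"
  have tM: "t g \<in> M" if "g \<in> carrier G" for g
    using that a s by (simp add: t_def M_iff AutM_closed pa)
  have t: "t \<in> carrier G \<rightarrow>\<^sub>E M" using tM by (auto simp: t_def)
  have as: "\<alpha> (s g) = t g \<otimes>\<^bsub>E\<^esub> s g" if "g \<in> carrier G" for g
    using that a s by (simp add: t_def E.m_assoc AutM_closed)
  have "act_C G c (eps_of G gs s) = (\<lambda>p\<in>?P. eps_of G gs s p \<otimes>\<^bsub>E\<^esub> cobd t p)"
    unfolding act_C_def
  proof (rule restrict_ext)
    fix p assume "p \<in> ?P"
    then obtain g h where p: "p = (g, h)" and g: "g \<in> carrier G" and h: "h \<in> carrier G" by auto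
    let ?e = "eps_of G gs s (g, h)"
    have e: "?e \<in> M" using g h by (simp add: eps_closed)
    have gt: "gam G gs g (t h) \<in> M" using g h tM by (simp add: gam_closed)
    have gh: "g \<otimes> h \<in> carrier G" using g h by simp
    note car = M_carrier[OF e] M_carrier[OF gt] M_carrier[OF tM[OF g]] M_carrier[OF tM[OF h]]
      M_carrier[OF tM[OF gh]] s(1)[OF g] s(1)[OF h] s(1)[OF gh]
    \<comment> \<open>Both sides are \<alpha> applied to the product rule for s(g) s(h); the right
      side is now brought to the form of an element of \<open>M\<close> times s(gh), which can then
      be cancelled.\<close>
    have "\<alpha> ?e \<otimes>\<^bsub>E\<^esub> \<alpha> (s (g \<otimes> h)) = \<alpha> (s g) \<otimes>\<^bsub>E\<^esub> \<alpha> (s h)"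
      using section_mult[OF g h] a car by (simp flip: AutM_mult)
    also have "\<dots> = t g \<otimes>\<^bsub>E\<^esub> (s g \<otimes>\<^bsub>E\<^esub> t h) \<otimes>\<^bsub>E\<^esub> s h"
      using car by (simp add: as g h E.m_assoc)
    also have "\<dots> = t g \<otimes>\<^bsub>E\<^esub> gam G gs g (t h) \<otimes>\<^bsub>E\<^esub> (s g \<otimes>\<^bsub>E\<^esub> s h)"
      using car by (simp add: section_conj[OF g tM[OF h]] E.m_assoc)
    also have "\<dots> = t g \<otimes>\<^bsub>E\<^esub> gam G gs g (t h) \<otimes>\<^bsub>E\<^esub> ?e \<otimes>\<^bsub>E\<^esub> s (g \<otimes> h)"
      using car by (simp add: section_mult[OF g h] E.m_assoc)
    finally have "\<alpha> ?e \<otimes>\<^bsub>E\<^esub> t (g \<otimes> h) \<otimes>\<^bsub>E\<^esub> s (g \<otimes> h) =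
        t g \<otimes>\<^bsub>E\<^esub> gam G gs g (t h) \<otimes>\<^bsub>E\<^esub> ?e \<otimes>\<^bsub>E\<^esub> s (g \<otimes> h)"
      using car a by (simp add: as[OF gh] E.m_assoc AutM_closed)
    then have "\<alpha> ?e \<otimes>\<^bsub>E\<^esub> t (g \<otimes> h) = t g \<otimes>\<^bsub>E\<^esub> gam G gs g (t h) \<otimes>\<^bsub>E\<^esub> ?e"
      using car a by (simp add: AutM_closed)
    then have "\<alpha> ?e = t g \<otimes>\<^bsub>E\<^esub> gam G gs g (t h) \<otimes>\<^bsub>E\<^esub> ?e \<otimes>\<^bsub>E\<^esub> inv\<^bsub>E\<^esub> t (g \<otimes> h)"
      using car a by (simp add: AutM_closed E.inv_solve_right)
    also have "\<dots> = ?e \<otimes>\<^bsub>E\<^esub> (gam G gs g (t h) \<otimes>\<^bsub>E\<^esub> inv\<^bsub>E\<^esub> t (g \<otimes> h) \<otimes>\<^bsub>E\<^esub> t g)"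
      using e gt tM[OF g] tM[OF gh]
      by (simp add: E.m_assoc M_carrier M_inv M_mult M_commute M_lcomm)
    finally show "c (eps_of G gs s p) = eps_of G gs s p \<otimes>\<^bsub>E\<^esub> cobd t p"
      using g h e by (simp add: p cm cobd_def)
  qed
  then show "c \<in> Stab_C G gs (eps_of G gs s)"
    using cC H2class_shift[OF eps_closed t] by (simp add: Stab_C_def)
qed

text \<open>Equality of classes supplies a cochain \<open>t\<close> relating the cocycle to its
  image under \<open>c\<close>. The map m s(g) to c(m) t(g) s(g) is then multiplicative precisely by
  this relation, and it restricts to \<open>c\<close> on \<open>M\<close>.\<close>

lemma Stab_C_subset: "Stab_C G gs (eps_of G gs s) \<subseteq> eta_M G gs ` Wset G gs"
proof
  let ?P = "carrier G \<times> carrier G"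
  let ?e = "eps_of G gs s"
  fix c assume c: "c \<in> Stab_C G gs ?e"
  then have cC: "c \<in> Cset G gs" by (simp add: Stab_C_def)
  then have "c \<in> auto (Mgroup G gs)" by (simp add: Cset_def)
  then have c_hom: "c \<in> hom (Mgroup G gs) (Mgroup G gs)" and c_bij: "bij_betw c M M"
    and c_ext: "c \<in> extensional M"
    by (auto simp: auto_def Bij_def Mgroup_def)
  have cM: "c m \<in> M" if "m \<in> M" for m using c_bij that by (auto simp: bij_betw_def)
  have c_mult: "c (m \<otimes>\<^bsub>E\<^esub> n) = c m \<otimes>\<^bsub>E\<^esub> c n" if "m \<in> M" "n \<in> M" for m n
    using hom_mult[OF c_hom] that by (simp add: Mgroup_def)
  have c_gam: "c (gam G gs g m) = gam G gs g (c m)" if "g \<in> carrier G" "m \<in> M" for g m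
  proof -
    have "compose M c (gam G gs g) m = compose M (gam G gs g) c m"
      using cC that by (simp add: Cset_def)
    then show ?thesis using that by (simp add: compose_def)
  qed
  have "act_C G c ?e \<in> H2class G gs (act_C G c ?e)"
    by (rule H2class_self) (auto simp: act_C_def intro!: cM eps_closed)
  then have "act_C G c ?e \<in> H2class G gs ?e" using c by (simp add: Stab_C_def)
  then obtain t where t: "t \<in> carrier G \<rightarrow>\<^sub>E M"
    and ct: "act_C G c ?e = (\<lambda>p\<in>?P. ?e p \<otimes>\<^bsub>E\<^esub> cobd t p)"
    by (auto simp: H2class_def B2_eq)
  have tM: "t g \<in> M" if "g \<in> carrier G" for g using t that by auto
  have ce: "c (?e (g, h)) = ?e (g, h) \<otimes>\<^bsub>E\<^esub> (gam G gs g (t h) \<otimes>\<^bsub>E\<^esub> inv\<^bsub>E\<^esub> t (g \<otimes> h) \<otimes>\<^bsub>E\<^esub> t g)"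
    if "g \<in> carrier G" "h \<in> carrier G" for g h
    using fun_cong[OF ct, of "(g, h)"] that by (simp add: act_C_def cobd_def)
  \<comment> \<open>The factor of \<open>x\<close> in \<open>M\<close> is recovered as x s(\<pi>
    x)^-1, so no choice of decomposition enters the definition.\<close>
  define \<alpha> where "\<alpha> = (\<lambda>x\<in>carrier E. c (x \<otimes>\<^bsub>E\<^esub> inv\<^bsub>E\<^esub> s (\<pi> x)) \<otimes>\<^bsub>E\<^esub> t (\<pi> x) \<otimes>\<^bsub>E\<^esub> s (\<pi> x))"
  have decomp: "\<exists>m g. m \<in> M \<and> g \<in> carrier G \<and> x = m \<otimes>\<^bsub>E\<^esub> s g" if "x \<in> carrier E" for x
    using that same_fibre[of x "s (\<pi> x)"] s by (metis pr.hom_closed)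
  have proj_ms: "\<pi> (m \<otimes>\<^bsub>E\<^esub> s g) = g" if "m \<in> M" "g \<in> carrier G" for m g
    using that s by (simp add: M_iff)
  have al: "\<alpha> (m \<otimes>\<^bsub>E\<^esub> s g) = c m \<otimes>\<^bsub>E\<^esub> t g \<otimes>\<^bsub>E\<^esub> s g" if "m \<in> M" "g \<in> carrier G" for m g
    using that s by (simp add: \<alpha>_def M_iff E.m_assoc)
  have proj_al: "\<pi> (\<alpha> x) = \<pi> x" if x: "x \<in> carrier E" for x
  proof -
    obtain m g where "m \<in> M" "g \<in> carrier G" "x = m \<otimes>\<^bsub>E\<^esub> s g" using decomp[OF x] by blast
    then show ?thesis using proj_ms[OF M_mult[OF cM tM]] by (simp only: al proj_ms)
  qed
  have \<alpha>W: "\<alpha> \<in> Wset G gs"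
  proof (rule WsetI)
    show "inj_on \<alpha> (carrier E)"
    proof (rule inj_onI)
      fix x y assume x: "x \<in> carrier E" and y: "y \<in> carrier E" and eq: "\<alpha> x = \<alpha> y"
      obtain m g where mg: "m \<in> M" "g \<in> carrier G" "x = m \<otimes>\<^bsub>E\<^esub> s g" using decomp[OF x] by blast
      obtain n h where nh: "n \<in> M" "h \<in> carrier G" "y = n \<otimes>\<^bsub>E\<^esub> s h" using decomp[OF y] by blast
      have "g = h" using proj_al[OF x] proj_al[OF y] eq mg nh by (metis proj_ms)
      then have "c m \<otimes>\<^bsub>E\<^esub> t g \<otimes>\<^bsub>E\<^esub> s g = c n \<otimes>\<^bsub>E\<^esub> t g \<otimes>\<^bsub>E\<^esub> s g"
        using eq mg nh by (simp add: al)
      then have "c m = c n"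
        using mg nh cM tM s by (simp add: M_carrier)
      then have "m = n" using c_bij mg(1) nh(1) by (meson bij_betw_def inj_onD)
      then show "x = y" using mg nh \<open>g = h\<close> by simp
    qed
    show "\<alpha> \<in> hom E E"
    proof (rule homI)
      fix x assume "x \<in> carrier E"
      then obtain m g where "m \<in> M" "g \<in> carrier G" "x = m \<otimes>\<^bsub>E\<^esub> s g" using decomp by blast
      then show "\<alpha> x \<in> carrier E" by (simp add: al cM tM M_carrier s)
    next
      fix x y assume x: "x \<in> carrier E" and y: "y \<in> carrier E"
      obtain m g where m: "m \<in> M" and g: "g \<in> carrier G" and xe: "x = m \<otimes>\<^bsub>E\<^esub> s g"
        using decomp[OF x] by blast
      obtain n h where n: "n \<in> M" and h: "h \<in> carrier G" and ye: "y = n \<otimes>\<^bsub>E\<^esub> s h"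
        using decomp[OF y] by blast
      have gh: "g \<otimes> h \<in> carrier G" using g h by simp
      have eM: "?e (g, h) \<in> M" using g h by (simp add: eps_closed)
      note Ms = m n cM[OF m] cM[OF n] tM[OF g] tM[OF h] tM[OF gh] eM
        gam_closed[OF g n] gam_closed[OF g cM[OF n]] gam_closed[OF g tM[OF h]]
      note car = Ms[THEN M_carrier] s(1)[OF g] s(1)[OF h] s(1)[OF gh]
      have "x \<otimes>\<^bsub>E\<^esub> y = m \<otimes>\<^bsub>E\<^esub> (s g \<otimes>\<^bsub>E\<^esub> n) \<otimes>\<^bsub>E\<^esub> s h"
        using car by (simp add: xe ye E.m_assoc)
      also have "\<dots> = m \<otimes>\<^bsub>E\<^esub> gam G gs g n \<otimes>\<^bsub>E\<^esub> (s g \<otimes>\<^bsub>E\<^esub> s h)"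
        using car by (simp add: section_conj[OF g n] E.m_assoc)
      also have "\<dots> = m \<otimes>\<^bsub>E\<^esub> gam G gs g n \<otimes>\<^bsub>E\<^esub> ?e (g, h) \<otimes>\<^bsub>E\<^esub> s (g \<otimes> h)"
        using car by (simp add: section_mult[OF g h] E.m_assoc)
      finally have "\<alpha> (x \<otimes>\<^bsub>E\<^esub> y) =
          c (m \<otimes>\<^bsub>E\<^esub> gam G gs g n \<otimes>\<^bsub>E\<^esub> ?e (g, h)) \<otimes>\<^bsub>E\<^esub> t (g \<otimes> h) \<otimes>\<^bsub>E\<^esub> s (g \<otimes> h)"
        using Ms gh by (simp add: al M_mult)
      also have "c (m \<otimes>\<^bsub>E\<^esub> gam G gs g n \<otimes>\<^bsub>E\<^esub> ?e (g, h)) \<otimes>\<^bsub>E\<^esub> t (g \<otimes> h) =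
          c m \<otimes>\<^bsub>E\<^esub> gam G gs g (c n) \<otimes>\<^bsub>E\<^esub> (c (?e (g, h)) \<otimes>\<^bsub>E\<^esub> t (g \<otimes> h))"
        using Ms by (simp add: c_mult M_mult c_gam[OF g n] E.m_assoc M_carrier cM)
      \<comment> \<open>The coboundary relation enters here: its factor t(gh)^-1 cancels against the
        t(gh) produced by \<alpha>.\<close>
      also have "c (?e (g, h)) \<otimes>\<^bsub>E\<^esub> t (g \<otimes> h) = ?e (g, h) \<otimes>\<^bsub>E\<^esub> gam G gs g (t h) \<otimes>\<^bsub>E\<^esub> t g"
        using car by (simp add: ce[OF g h] E.m_assoc M_commute[OF tM[OF g] tM[OF gh]] E.inv_cancel_left)
      also have "c m \<otimes>\<^bsub>E\<^esub> gam G gs g (c n) \<otimes>\<^bsub>E\<^esub> (?e (g, h) \<otimes>\<^bsub>E\<^esub> gam G gs g (t h) \<otimes>\<^bsub>E\<^esub> t g) =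
          c m \<otimes>\<^bsub>E\<^esub> t g \<otimes>\<^bsub>E\<^esub> gam G gs g (c n) \<otimes>\<^bsub>E\<^esub> gam G gs g (t h) \<otimes>\<^bsub>E\<^esub> ?e (g, h)"
        using Ms by (simp add: E.m_assoc M_carrier M_mult M_commute M_lcomm)
      also have "\<dots> \<otimes>\<^bsub>E\<^esub> s (g \<otimes> h) =
          c m \<otimes>\<^bsub>E\<^esub> t g \<otimes>\<^bsub>E\<^esub> gam G gs g (c n \<otimes>\<^bsub>E\<^esub> t h) \<otimes>\<^bsub>E\<^esub> s g \<otimes>\<^bsub>E\<^esub> s h"
        using car Ms by (simp add: E.m_assoc section_mult[OF g h] gam_mult[OF g])
      also have "\<dots> = c m \<otimes>\<^bsub>E\<^esub> t g \<otimes>\<^bsub>E\<^esub> (s g \<otimes>\<^bsub>E\<^esub> (c n \<otimes>\<^bsub>E\<^esub> t h)) \<otimes>\<^bsub>E\<^esub> s h"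
        unfolding section_conj[OF g M_mult[OF cM[OF n] tM[OF h]]]
        using car Ms by (simp add: E.m_assoc gam_mult[OF g])
      also have "\<dots> = \<alpha> x \<otimes>\<^bsub>E\<^esub> \<alpha> y"
        using car m n g h by (simp add: xe ye al E.m_assoc)
      finally show "\<alpha> (x \<otimes>\<^bsub>E\<^esub> y) = \<alpha> x \<otimes>\<^bsub>E\<^esub> \<alpha> y" .
    qed
  qed (simp_all add: proj_al, simp add: \<alpha>_def)
  \<comment> \<open>The section need not be normalized, so \<open>m\<close> is written as m s(1)^-1
    s(1). The cocycle takes the value s(1) at (1,1), and the coboundary relation there gives c(s(1))
    = s(1) t(1).\<close>
  have "\<alpha> m = c m" if m: "m \<in> M" for m
  proof -
    let ?s = "s \<one>" and ?t = "t \<one>"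
    have s1: "?s \<in> M" using s by (simp add: M_iff)
    have "?e (\<one>, \<one>) = ?s"
      using s by (simp add: eps_of_def E.m_assoc)
    then have "c ?s = ?s \<otimes>\<^bsub>E\<^esub> ?t"
      using ce[of \<one> \<one>] tM[of \<one>] by (simp add: gam_one M_carrier)
    moreover have "m = (m \<otimes>\<^bsub>E\<^esub> inv\<^bsub>E\<^esub> ?s) \<otimes>\<^bsub>E\<^esub> ?s"
      using m s1 by (simp add: E.m_assoc M_carrier)
    ultimately have "c m = c (m \<otimes>\<^bsub>E\<^esub> inv\<^bsub>E\<^esub> ?s) \<otimes>\<^bsub>E\<^esub> (?s \<otimes>\<^bsub>E\<^esub> ?t)"
      using c_mult[of "m \<otimes>\<^bsub>E\<^esub> inv\<^bsub>E\<^esub> ?s" ?s] m s1 by (simp add: M_mult M_inv)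
    also have "\<dots> = \<alpha> (m \<otimes>\<^bsub>E\<^esub> inv\<^bsub>E\<^esub> ?s \<otimes>\<^bsub>E\<^esub> ?s)"
      using al[of "m \<otimes>\<^bsub>E\<^esub> inv\<^bsub>E\<^esub> ?s" \<one>] m s1 tM[of \<one>] cM[of "m \<otimes>\<^bsub>E\<^esub> inv\<^bsub>E\<^esub> ?s"] M_commute[of ?s ?t]
      by (simp add: M_mult M_inv E.m_assoc M_carrier)
    finally show ?thesis using m s1 by (simp add: E.m_assoc M_carrier)
  qed
  then have "eta_M G gs \<alpha> = c"
    using c_ext by (auto simp: eta_M_def intro: extensionalityI[of _ M])
  then show "c \<in> eta_M G gs ` Wset G gs" using \<alpha>W by blast
qed

end

section \<open>The isomorphism of \<open>V\<close> with the group of 1-cocycles\<close>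

definition cocycle_of :: "((bool \<times> nat) list set \<Rightarrow> (bool \<times> nat) list set) \<Rightarrow> 'a \<Rightarrow> (bool \<times> nat) list set" where
  "cocycle_of \<alpha> = (\<lambda>g\<in>carrier G. \<alpha> (lift_elt G gs g) \<otimes>\<^bsub>E\<^esub> inv\<^bsub>E\<^esub> lift_elt G gs g)"

lemma VsetD:
  assumes "\<alpha> \<in> Vset G gs"
  shows "\<alpha> \<in> AutM G gs" "\<And>x. x \<in> carrier E \<Longrightarrow> \<pi> (\<alpha> x) = \<pi> x" "\<And>m. m \<in> M \<Longrightarrow> \<alpha> m = m"
  using assms by (auto simp: Vset_iff Wset_iff)

lemma Vset_quotient_in_M:
  assumes "\<alpha> \<in> Vset G gs" "x \<in> carrier E"
  shows "\<alpha> x \<otimes>\<^bsub>E\<^esub> inv\<^bsub>E\<^esub> x \<in> M"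
  using VsetD[OF assms(1)] assms(2) by (simp add: M_iff AutM_closed)

text \<open>Since \<alpha> fixes \<open>M\<close> pointwise, replacing \<open>x\<close> by n x only
  conjugates the quotient by \<open>n\<close>. The quotient lies in the abelian group
  \<open>M\<close>, so it does not change.\<close>

lemma cocycle_of_proj:
  assumes \<alpha>: "\<alpha> \<in> Vset G gs" and x: "x \<in> carrier E"
  shows "cocycle_of \<alpha> (\<pi> x) = \<alpha> x \<otimes>\<^bsub>E\<^esub> inv\<^bsub>E\<^esub> x"
proof -
  let ?y = "lift_elt G gs (\<pi> x)"
  have "?y \<in> carrier E" "\<pi> ?y = \<pi> x" using x lift_elt by auto
  then obtain n where n: "n \<in> M" "?y = n \<otimes>\<^bsub>E\<^esub> x" using x by (metis same_fibre)
  note a = VsetD[OF \<alpha>]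
  let ?q = "\<alpha> x \<otimes>\<^bsub>E\<^esub> inv\<^bsub>E\<^esub> x"
  have "\<alpha> ?y \<otimes>\<^bsub>E\<^esub> inv\<^bsub>E\<^esub> ?y = n \<otimes>\<^bsub>E\<^esub> ?q \<otimes>\<^bsub>E\<^esub> inv\<^bsub>E\<^esub> n"
    using n x a by (simp add: AutM_mult M_carrier E.m_assoc E.inv_mult_group AutM_closed)
  also have "\<dots> = ?q"
    using M_commute[OF n(1) Vset_quotient_in_M[OF \<alpha> x]] n x a(1)
    by (simp add: E.m_assoc M_carrier AutM_closed)
  finally show ?thesis using x by (simp add: cocycle_of_def)
qed

lemma Vset_apply:
  assumes "\<alpha> \<in> Vset G gs" "x \<in> carrier E"
  shows "\<alpha> x = cocycle_of \<alpha> (\<pi> x) \<otimes>\<^bsub>E\<^esub> x"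
  using assms VsetD(1)[OF assms(1)] by (simp add: cocycle_of_proj E.m_assoc AutM_closed)

text \<open>The quotient for x y is the quotient for x times the conjugate by x of the quotient for
  y, and that conjugation is the action of \<open>G\<close>.\<close>

lemma cocycle_of_in_Z1:
  assumes \<alpha>: "\<alpha> \<in> Vset G gs"
  shows "cocycle_of \<alpha> \<in> Z1 G gs"
proof -
  note a = VsetD(1)[OF \<alpha>]
  have M: "cocycle_of \<alpha> g \<in> M" if "g \<in> carrier G" for g
    using that by (rule projE) (simp add: \<alpha> cocycle_of_proj Vset_quotient_in_M)
  have "cocycle_of \<alpha> (g \<otimes> h) = cocycle_of \<alpha> g \<otimes>\<^bsub>E\<^esub> gam G gs g (cocycle_of \<alpha> h)"
    if gh: "g \<in> carrier G" "h \<in> carrier G" for g h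
  proof -
    obtain x y where xy: "x \<in> carrier E" "y \<in> carrier E" "g = \<pi> x" "h = \<pi> y"
      using gh by (metis projE)
    then have "cocycle_of \<alpha> (g \<otimes> h) = \<alpha> (x \<otimes>\<^bsub>E\<^esub> y) \<otimes>\<^bsub>E\<^esub> inv\<^bsub>E\<^esub> (x \<otimes>\<^bsub>E\<^esub> y)"
      using cocycle_of_proj[OF \<alpha>, of "x \<otimes>\<^bsub>E\<^esub> y"] by simp
    also have "\<dots> = (\<alpha> x \<otimes>\<^bsub>E\<^esub> inv\<^bsub>E\<^esub> x) \<otimes>\<^bsub>E\<^esub> (x \<otimes>\<^bsub>E\<^esub> (\<alpha> y \<otimes>\<^bsub>E\<^esub> inv\<^bsub>E\<^esub> y) \<otimes>\<^bsub>E\<^esub> inv\<^bsub>E\<^esub> x)"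
      using xy a by (simp add: AutM_mult AutM_closed E.m_assoc E.inv_mult_group E.inv_cancel_left)
    finally show ?thesis
      using xy \<alpha> by (simp add: cocycle_of_proj gam_proj Vset_quotient_in_M)
  qed
  then show ?thesis using M by (auto simp: Z1_def cocycle_of_def)
qed

text \<open>Provides the inverse of \<open>cocycle_of\<close>: the crossed homomorphism law for
  \<open>f\<close> is exactly what makes the twisted map multiplicative.\<close>

lemma Z1_imp_Vset:
  assumes f: "f \<in> Z1 G gs"
  defines "\<alpha> \<equiv> \<lambda>x\<in>carrier E. f (\<pi> x) \<otimes>\<^bsub>E\<^esub> x"
  shows "\<alpha> \<in> Vset G gs" "cocycle_of \<alpha> = f"
proof -
  have fM: "f g \<in> M" if "g \<in> carrier G" for g using f that by (auto simp: Z1_def)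
  have f_ext: "f \<in> extensional (carrier G)" using f by (auto simp: Z1_def PiE_def)
  have f_mult: "f (g \<otimes> h) = f g \<otimes>\<^bsub>E\<^esub> gam G gs g (f h)" if "g \<in> carrier G" "h \<in> carrier G" for g h
    using f that by (simp add: Z1_def)
  \<comment> \<open>The cocycle law at (1,1); this value is the reason why \<alpha> fixes
    \<open>M\<close> pointwise.\<close>
  have f_one: "f \<one> = \<one>\<^bsub>E\<^esub>"
    using f_mult[of \<one> \<one>] fM[of \<one>] by (simp add: gam_one M_carrier)
  have proj: "\<pi> (\<alpha> x) = \<pi> x" if "x \<in> carrier E" for x
    using that fM[of "\<pi> x"] by (simp add: \<alpha>_def M_iff)
  have "\<alpha> \<in> Wset G gs"
  proof (rule WsetI)
    show "\<alpha> \<in> hom E E"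
    proof (rule homI)
      fix x y assume "x \<in> carrier E" "y \<in> carrier E"
      then show "\<alpha> (x \<otimes>\<^bsub>E\<^esub> y) = \<alpha> x \<otimes>\<^bsub>E\<^esub> \<alpha> y"
        using fM[of "\<pi> x"] fM[of "\<pi> y"]
        by (simp add: \<alpha>_def f_mult gam_proj E.m_assoc M_carrier E.inv_cancel_left)
    qed (simp add: \<alpha>_def fM M_carrier)
    show "inj_on \<alpha> (carrier E)"
    proof (rule inj_onI)
      fix x y assume xy: "x \<in> carrier E" "y \<in> carrier E" "\<alpha> x = \<alpha> y"
      then have "\<pi> x = \<pi> y" using proj by metis
      then have "f (\<pi> x) \<otimes>\<^bsub>E\<^esub> x = f (\<pi> x) \<otimes>\<^bsub>E\<^esub> y" using xy by (simp add: \<alpha>_def)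
      then show "x = y" using xy fM[of "\<pi> x"] by (simp add: M_carrier)
    qed
  qed (auto simp: proj, simp add: \<alpha>_def)
  then show V: "\<alpha> \<in> Vset G gs"
    by (auto simp: Vset_iff \<alpha>_def M_iff f_one)
  show "cocycle_of \<alpha> = f"
  proof (rule extensionalityI[OF _ f_ext])
    fix g assume "g \<in> carrier G"
    then obtain x where x: "x \<in> carrier E" "g = \<pi> x" by (rule projE)
    have "cocycle_of \<alpha> (\<pi> x) = f (\<pi> x) \<otimes>\<^bsub>E\<^esub> x \<otimes>\<^bsub>E\<^esub> inv\<^bsub>E\<^esub> x"
      using cocycle_of_proj[OF V x(1)] x(1) by (simp add: \<alpha>_def)
    then show "cocycle_of \<alpha> g = f g"
      using x fM[of g] by (simp add: E.m_assoc M_carrier)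
  qed (simp add: cocycle_of_def)
qed

lemma Vset_iso_Z1: "(AutoGroup E)\<lparr>carrier := Vset G gs\<rparr> \<cong> Z1_group G gs"
proof (rule is_isoI, rule isoI)
  let ?V = "(AutoGroup E)\<lparr>carrier := Vset G gs\<rparr>"
  show "cocycle_of \<in> hom ?V (Z1_group G gs)"
  proof (rule homI)
    fix \<alpha> \<beta> assume "\<alpha> \<in> carrier ?V" "\<beta> \<in> carrier ?V"
    then have \<alpha>: "\<alpha> \<in> Vset G gs" and \<beta>: "\<beta> \<in> Vset G gs" by auto
    note a = VsetD(1)[OF \<alpha>] and b = VsetD(1)[OF \<beta>]
    have "compose (carrier E) \<alpha> \<beta> \<in> AutM G gs"
      using subgroup.m_closed[OF subgroup_AutM a b] a b by (simp add: BijGroup_mult_AutM)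
    then have \<gamma>: "compose (carrier E) \<alpha> \<beta> \<in> Vset G gs"
      using VsetD[OF \<alpha>] VsetD[OF \<beta>]
      by (simp add: Vset_iff Wset_iff compose_def AutM_closed M_carrier)
    have "cocycle_of (compose (carrier E) \<alpha> \<beta>) = (\<lambda>g\<in>carrier G. cocycle_of \<alpha> g \<otimes>\<^bsub>E\<^esub> cocycle_of \<beta> g)"
    proof (rule extensionalityI[of _ "carrier G"])
      fix g assume "g \<in> carrier G"
      then obtain x where x: "x \<in> carrier E" "g = \<pi> x" by (rule projE)
      have bx: "\<beta> x \<in> carrier E" "\<pi> (\<beta> x) = \<pi> x" using VsetD(2)[OF \<beta>] b x by (auto simp: AutM_closed)
      \<comment> \<open>The cocycle of \<alpha> is evaluated at the preimage
        \<open>\<beta> x\<close> instead of \<open>x\<close>, so that the quotient of the composite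
        splits as a product of the two quotients.\<close>
      have "cocycle_of \<alpha> (\<pi> x) = \<alpha> (\<beta> x) \<otimes>\<^bsub>E\<^esub> inv\<^bsub>E\<^esub> \<beta> x"
        using cocycle_of_proj[OF \<alpha> bx(1)] bx(2) by simp
      then show "cocycle_of (compose (carrier E) \<alpha> \<beta>) g =
          (\<lambda>g\<in>carrier G. cocycle_of \<alpha> g \<otimes>\<^bsub>E\<^esub> cocycle_of \<beta> g) g"
        using x bx a by (simp add: cocycle_of_proj[OF \<gamma>] cocycle_of_proj[OF \<beta>] compose_eq
            E.m_assoc E.inv_cancel_left AutM_closed)
    qed (auto simp: cocycle_of_def)
    then show "cocycle_of (\<alpha> \<otimes>\<^bsub>?V\<^esub> \<beta>) = cocycle_of \<alpha> \<otimes>\<^bsub>Z1_group G gs\<^esub> cocycle_of \<beta>"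
      using a b by (simp add: AutoGroup_def BijGroup_mult_AutM Z1_group_def)
  qed (simp add: Z1_group_def cocycle_of_in_Z1)
  \<comment> \<open>An element of \<open>V\<close> is recovered from its cocycle on the carrier by
    \<open>Vset_apply\<close>, and extensionality settles the rest.\<close>
  have "inj_on cocycle_of (Vset G gs)"
  proof (rule inj_onI)
    fix \<alpha> \<beta> assume V: "\<alpha> \<in> Vset G gs" "\<beta> \<in> Vset G gs" and eq: "cocycle_of \<alpha> = cocycle_of \<beta>"
    show "\<alpha> = \<beta>"
      by (rule extensionalityI[of _ "carrier E"])
        (use V eq AutMD(3)[OF VsetD(1)] in \<open>simp_all add: Vset_apply\<close>)
  qed
  moreover have "cocycle_of ` Vset G gs = Z1 G gs"
    using cocycle_of_in_Z1 Z1_imp_Vset by (auto intro!: image_eqI)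
  ultimately show "bij_betw cocycle_of (carrier ?V) (carrier (Z1_group G gs))"
    by (simp add: bij_betw_def Z1_group_def)
qed

end

theorem theorem4p2:
  fixes G :: "('a, 'b) monoid_scheme" and gs :: "'a list"
  assumes "group G" and "finite (carrier G)"
    and "set gs \<subseteq> carrier G" and "generate G (set gs) = carrier G"
    and "F_central G 0 \<noteq> {\<one>\<^bsub>G\<^esub>}"
  shows "(eta_G G gs ` AutM G gs = auto G
         \<and> AutM_group G gs Mod Wset G gs \<cong> AutoGroup G)
    \<and> ((AutM_group G gs)\<lparr>carrier := Wset G gs\<rparr> Mod Vset G gs
           \<cong> (AutoGroup (Mgroup G gs))\<lparr>carrier := eta_M G gs ` Wset G gs\<rparr>
         \<and> (\<forall>s. (\<forall>g \<in> carrier G. s g \<in> carrier (Gstar G gs) \<and> proj G gs (s g) = g)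
              \<longrightarrow> eta_M G gs ` Wset G gs = Stab_C G gs (eps_of G gs s)))
    \<and> (AutoGroup (Gstar G gs))\<lparr>carrier := Vset G gs\<rparr> \<cong> Z1_group G gs"
proof -
  interpret covering G gs
    using assms by (simp add: covering_def covering_axioms_def)
  have "eta_M G gs ` Wset G gs = Stab_C G gs (eps_of G gs s)"
    if "\<forall>g \<in> carrier G. s g \<in> carrier (Gstar G gs) \<and> proj G gs (s g) = g" for s
    by (rule equalityI[OF eta_M_Wset_subset Stab_C_subset]) (use that in auto)
  then show ?thesis
    using eta_G_image AutM_Mod_Wset Wset_Mod_Vset Vset_iso_Z1 by blast
qed

end
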